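(* Let $b\in\mathbb{R}_+^C$, $(a_{c,d})$, $\nu$, $\alpha$, $T$, and the objects $f_{c,\beta}$, $F_{k,\bm\beta}$, $\mu_{k,\bm\beta}$, $\bm\beta^{(k)}$, $t_k$ be as defined in the context. For $t>0$ let $k_t=\max\{k\in\{1,\dots,C\}: t>t_k\}$, and $k_0=1$. For $c\in\{1,\dots,C\}$ define $$m^*_c(t)=\bigl(b_c-\beta^{(k_t)}_c\bigr)+\Bigl(f^{-1}_{c,\beta_c^{(k_t)}}\bigl(F_{k_t,\bm\beta^{(k_t)}}\bigl(\mu_{k_t,\bm\beta^{(k_t)}}(t-t_{k_t})\bigr)\bigr)\Bigr)_+ ,\qquad t\in[0,\alpha],$$ where $(x)_+=\max(x,0)$. Then $m^*=(m^*_1,\dots,m^*_C)$ is the solution on $[0,\alpha]$ of the differential inclusion $$\dot m\in F(m):=\operatorname{conv}\Bigl\{f_{c,b_c}(m_c)\,e_c\ :\ c\in\arg\max_{k\in\{1,\dots,C\}}f_{k,b_k}(m_k)\Bigr\},\qquad m(0)=0,$$ where $e_c$ is the $c$-th standard basis vector of $\mathbb{R}^C$ and $\operatorname{conv}$ denotes the convex hull.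
   Context: $N,T,C,D\ge1$ are integers and $T=\alpha N$ with $\alpha>0$. $b_1,\dots,b_C\ge0$ with $\sum_cb_c=1$, $\nu$ is a probability distribution on $\{1,\dots,D\}$, and $a_{c,d}>0$ for all $c,d$. For $\beta\ge0$ and $c\in\{1,\dots,C\}$, $$f_{c,\beta}(z)=\sum_{d=1}^D\bigl(1-e^{-a_{c,d}(\beta-z)}\bigr)\nu(d),$$ which is strictly decreasing in $z\in\mathbb{R}$, with inverse $f_{c,\beta}^{-1}$. Classes are ordered so that $f_{1,b_1}(0)\ge f_{2,b_2}(0)\ge\dots\ge f_{C,b_C}(0)$. For $k\in\{1,\dots,C\}$ and $\bm\beta\in\mathbb{R}_+^C$, $F_{k,\bm\beta}=\bigl(\sum_{c=1}^kf_{c,\beta_c}^{-1}\bigr)^{-1}$ (the inverse function of the sum of the inverse functions), and $\mu_{k,\bm\beta}$ is the solution of $\mu_{k,\bm\beta}'(t)=F_{k,\bm\beta}(\mu_{k,\bm\beta}(t))$, $\mu_{k,\bm\beta}(0)=0$; $\mu_{k,\bm\beta}$ is strictly increasing on $[0,\infty)$, and $\mu_{k,\bm\beta}^{-1}(x)$ is taken to be $+\infty$ if $x$ is not attained. For $c,k\in\{1,\dots,C\}$, define recursively $$\beta_c^{(k)}=\begin{cases}b_c&\text{if }k\le c,\\ \beta_c^{(k-1)}-f^{-1}_{c,\beta_c^{(k-1)}}\bigl(f_{k,b_k}(0)\bigr)&\text{otherwise,}\end{cases}\qquad \bm\beta^{(k)}=(\beta^{(k)}_c)_{c},$$ and $t_1=0$,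 and for $2\le k\le C$, $$t_k=\min\Bigl(T,\ t_{k-1}+\mu^{-1}_{k-1,\bm\beta^{(k-1)}}\bigl(F^{-1}_{k-1,\bm\beta^{(k-1)}}\bigl(f_{k,b_k}(0)\bigr)\bigr)\Bigr).$$ A solution of $\dot m\in F(m)$ on $[0,\alpha]$ with $m(0)=0$ is a function $m$ such that $m(t)=\int_0^t\phi(s)\,ds$ for all $t$, for some function $\phi$ with $\phi(t)\in F(m(t))$ for almost every $t$. *)

theory Defs
  imports "HOL-Probability.Probability"
begin

definition rate :: "nat \<Rightarrow> nat pmf \<Rightarrow> (nat \<Rightarrow> nat \<Rightarrow> real) \<Rightarrow> nat \<Rightarrow> real \<Rightarrow> real \<Rightarrow> real" where
  "rate D \<nu> a c \<beta> z = (\<Sum>d=1..D. (1 - exp (- a c d * (\<beta> - z))) * pmf \<nu> d)"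

text \<open>In the following definitions the family of functions \<open>f c \<beta>\<close> (later instantiated
  with \<open>rate D \<nu> a c \<beta>\<close>) is a parameter.\<close>

text \<open>The inverse of \<open>f c \<beta>\<close> is only defined on the range of \<open>f c \<beta>\<close> (for \<open>rate\<close>, the
  numbers below 1), so the sum of the inverses has to be inverted on the intersection of these
  ranges; outside of it \<open>inv\<close> returns arbitrary values.\<close>

definition agg_rate :: "(nat \<Rightarrow> real \<Rightarrow> real \<Rightarrow> real) \<Rightarrow> nat \<Rightarrow> (nat \<Rightarrow> real) \<Rightarrow> real \<Rightarrow> real" where
  "agg_rate f k \<beta> =
     inv_into (\<Inter>c\<in>{1..k}. range (f c (\<beta> c))) (\<lambda>y. \<Sum>c=1..k. inv (f c (\<beta> c)) y)"

text \<open>The solution is unique on \<open>[0,\<infinity>)\<close>; its values at negative times are irrelevant.\<close>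

definition traj :: "(nat \<Rightarrow> real \<Rightarrow> real \<Rightarrow> real) \<Rightarrow> nat \<Rightarrow> (nat \<Rightarrow> real) \<Rightarrow> real \<Rightarrow> real" where
  "traj f k \<beta> = (SOME \<mu>. \<mu> 0 = 0 \<and>
     (\<forall>t\<ge>0. (\<mu> has_real_derivative agg_rate f k \<beta> (\<mu> t)) (at t within {0..})))"

definition hit_time :: "(real \<Rightarrow> real) \<Rightarrow> real \<Rightarrow> ereal" where
  "hit_time \<mu> x = (if x \<in> \<mu> ` {0..} then ereal (inv_into {0..} \<mu> x) else \<infinity>)"

text \<open>Stages are numbered from 1; the value at stage 0 only starts the recursion.\<close>

fun residual :: "(nat \<Rightarrow> real \<Rightarrow> real \<Rightarrow> real) \<Rightarrow> (nat \<Rightarrow> real) \<Rightarrow> nat \<Rightarrow> nat \<Rightarrow> real" where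
  "residual f b 0 c = b c"
| "residual f b (Suc k) c =
     (if Suc k \<le> c then b c
      else residual f b k c - inv (f c (residual f b k c)) (f (Suc k) (b (Suc k)) 0))"

fun stage_time :: "(nat \<Rightarrow> real \<Rightarrow> real \<Rightarrow> real) \<Rightarrow> (nat \<Rightarrow> real) \<Rightarrow> real \<Rightarrow> nat \<Rightarrow> real" where
  "stage_time f b T 0 = 0"
| "stage_time f b T (Suc 0) = 0"
| "stage_time f b T (Suc (Suc k)) =
     real_of_ereal (min (ereal T)
       (ereal (stage_time f b T (Suc k)) +
        hit_time (traj f (Suc k) (residual f b (Suc k)))
          (inv (agg_rate f (Suc k) (residual f b (Suc k)))
             (f (Suc (Suc k)) (b (Suc (Suc k))) 0))))"

definition stage :: "(nat \<Rightarrow> real \<Rightarrow> real \<Rightarrow> real) \<Rightarrow> (nat \<Rightarrow> real) \<Rightarrow> real \<Rightarrow> nat \<Rightarrow> real \<Rightarrow> nat" where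
  "stage f b T C t = (if t = 0 then 1 else Max {k \<in> {1..C}. t > stage_time f b T k})"

definition mstar ::
  "(nat \<Rightarrow> real \<Rightarrow> real \<Rightarrow> real) \<Rightarrow> (nat \<Rightarrow> real) \<Rightarrow> real \<Rightarrow> nat \<Rightarrow> nat \<Rightarrow> real \<Rightarrow> real" where
  "mstar f b T C c t =
     (let k = stage f b T C t; \<beta> = residual f b k in
        (b c - \<beta> c) +
        max (inv (f c (\<beta> c)) (agg_rate f k \<beta> (traj f k \<beta> (t - stage_time f b T k)))) 0)"

text \<open>The space \<open>\<real>\<^sup>C\<close> is represented by \<^typ>\<open>real^'n\<close> together with a labelling \<open>\<iota>\<close> of the
  coordinates, a bijection from \<open>{1..C}\<close> onto the index type: the \<open>c\<close>-th coordinate of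
  \<open>m\<close> is \<open>m $ \<iota> c\<close> and the \<open>c\<close>-th standard basis vector is \<open>axis (\<iota> c) 1\<close>.\<close>

definition greedy_field ::
  "(nat \<Rightarrow> real \<Rightarrow> real \<Rightarrow> real) \<Rightarrow> (nat \<Rightarrow> real) \<Rightarrow> nat \<Rightarrow> (nat \<Rightarrow> 'n::finite) \<Rightarrow> real^'n \<Rightarrow> (real^'n) set"
where
  "greedy_field f b C \<iota> m =
     convex hull {f c (b c) (m $ \<iota> c) *\<^sub>R axis (\<iota> c) 1 | c.
       is_arg_max (\<lambda>k. f k (b k) (m $ \<iota> k)) (\<lambda>k. k \<in> {1..C}) c}"

definition incl_solution ::
  "('a::euclidean_space \<Rightarrow> 'a set) \<Rightarrow> real \<Rightarrow> (real \<Rightarrow> 'a) \<Rightarrow> bool" where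
  "incl_solution G \<alpha> m \<longleftrightarrow>
     (\<exists>\<phi>. set_integrable lebesgue {0..\<alpha>} \<phi> \<and>
          (\<forall>t\<in>{0..\<alpha>}. m t = (LINT s:{0..t}|lebesgue. \<phi> s)) \<and>
          (AE t in lebesgue. t \<in> {0..\<alpha>} \<longrightarrow> \<phi> t \<in> G (m t)))"

end

theory Submission
  imports Defs
begin

text \<open>With \<open>h c\<close> the inverse of \<open>x \<mapsto> f c x 0\<close> and \<open>y c = f c (b c) 0\<close>, the inverse of \<open>f c \<beta>\<close>
  is \<open>v \<mapsto> \<beta> - h c v\<close>. A state \<open>m\<close> reached by the dynamics is determined by the single number
  \<open>u = max\<^sub>c f c (b c) (m c)\<close>: coordinates below the maximum have not moved yet, so
  \<open>m c = max 0 (b c - h c u)\<close> for all \<open>c\<close>. The total mass is then a strictly decreasing function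
  of \<open>u\<close>, and since the velocities sum to \<open>u\<close> it satisfies a scalar equation with decreasing
  right-hand side, which has exactly one solution; this gives uniqueness. The trajectories of the
  successive stages are shifted pieces of the same mass function, and stage \<open>k\<close> begins when \<open>u\<close>
  reaches \<open>y k\<close>, so \<open>mstar\<close> has the form above as well. Away from the finitely many times at
  which \<open>u\<close> equals some \<open>y c\<close> it is differentiable, with nonnegative velocities supported on
  the active coordinates.\<close>

section \<open>Scalar equations with decreasing right-hand side\<close>

text \<open>Monotonicity takes the place of a Lipschitz condition: the squared distance of two
  solutions starts at 0 and has derivative \<open>2 * (x - y) * (F x - F y)\<close>, which is never
  positive.\<close>

lemma decreasing_ode_unique:
  fixes F x y :: "real \<Rightarrow> real"
  assumes F: "antimono F"
    and x: "\<And>t. t \<in> {0..S} \<Longrightarrow> (x has_real_derivative F (x t)) (at t within {0..S})"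
    and y: "\<And>t. t \<in> {0..S} \<Longrightarrow> (y has_real_derivative F (y t)) (at t within {0..S})"
    and "x 0 = y 0" and t: "t \<in> {0..S}"
  shows "x t = y t"
proof (cases "t = 0")
  case False
  define q where "q t = (x t - y t)\<^sup>2" for t
  have q: "(q has_real_derivative 2 * (x t - y t) * (F (x t) - F (y t))) (at t within {0..S})"
    if "t \<in> {0..S}" for t
    unfolding q_def by (rule derivative_eq_intros x y that refl)+ simp
  have "q t \<le> q 0"
  proof (rule DERIV_nonpos_imp_decreasing_open[where f = q])
    show "0 \<le> t" using t by simp
    show "continuous_on {0..t} q"
      by (rule continuous_on_subset[OF DERIV_continuous_on[OF q]]) (use t in auto)
  next
    fix s assume s: "0 < s" "s < t"
    have "(q has_real_derivative 2 * (x s - y s) * (F (x s) - F (y s))) (at s)"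
      using q[of s] s t by (simp add: at_within_Icc_at)
    moreover have "2 * (x s - y s) * (F (x s) - F (y s)) \<le> 0"
    proof (cases "x s \<le> y s")
      case True
      then show ?thesis using antimonoD[OF F True] by (simp add: mult_nonpos_nonneg)
    next
      case False
      then show ?thesis using antimonoD[OF F, of "y s" "x s"] by (simp add: mult_nonneg_nonpos)
    qed
    ultimately show "\<exists>D. (q has_real_derivative D) (at s) \<and> D \<le> 0" by blast
  qed
  then show ?thesis using assms(4) by (simp add: q_def)
qed (use assms in simp)

text \<open>Separation of variables: \<open>\<mu>\<close> inverts the time function
  \<open>\<theta>\<close>. Since \<open>F\<close> decays at least linearly towards \<open>B\<close>,
  that value is approached but never attained, and the solution is global.\<close>

lemma scalar_ode_exists:
  fixes F :: "real \<Rightarrow> real"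
  assumes F: "continuous_on UNIV F" and B: "B > 0" and L: "L > 0"
    and pos: "\<And>x. x < B \<Longrightarrow> 0 < F x"
    and bound: "\<And>x. 0 \<le> x \<Longrightarrow> x < B \<Longrightarrow> F x \<le> L * (B - x)"
  shows "\<exists>\<mu>. \<mu> 0 = 0 \<and> (\<forall>t\<ge>0. (\<mu> has_real_derivative F (\<mu> t)) (at t)) \<and>
    \<mu> ` {0..} = {0..<B}"
proof -
  \<comment> \<open>\<open>\<theta> x\<close> is the time needed to reach \<open>x\<close>; the linear bound makes it diverge at \<open>B\<close>. The
    integral starts at \<open>-1\<close> so that \<open>0\<close> is an interior point.\<close>
  define \<theta> where "\<theta> x = integral {-1..x} (\<lambda>x. 1 / F x) - integral {-1..0} (\<lambda>x. 1 / F x)" for x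
  have \<theta>0: "\<theta> 0 = 0" by (simp add: \<theta>_def)
  have der: "(\<theta> has_real_derivative 1 / F x) (at x)" if "-1 < x" "x < B" for x
  proof -
    have "continuous_on {-1..(x + B) / 2} (\<lambda>x. 1 / F x)"
      by (intro continuous_intros continuous_on_subset[OF F] subset_UNIV ballI)
        (use that pos in \<open>force simp: less_imp_neq[symmetric]\<close>)
    then have "((\<lambda>x. integral {-1..x} (\<lambda>x. 1 / F x)) has_real_derivative 1 / F x) (at x)"
      using integral_has_real_derivative[of "-1" "(x + B) / 2" "\<lambda>x. 1 / F x" x] that
      by (simp add: at_within_Icc_at)
    then show ?thesis
      unfolding \<theta>_def by (auto intro!: derivative_eq_intros)
  qed
  have mono: "\<theta> x < \<theta> y" if "-1 < x" "x < y" "y < B" for x y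
  proof (rule DERIV_pos_imp_increasing[OF that(2)])
    show "\<exists>D. (\<theta> has_real_derivative D) (at z) \<and> 0 < D" if "x \<le> z" "z \<le> y" for z
      using der[of z] pos[of z] that \<open>-1 < x\<close> \<open>y < B\<close> by (intro exI[of _ "1 / F z"]) auto
  qed
  have cont: "isCont \<theta> x" if "-1 < x" "x < B" for x
    using der[OF that] by (rule DERIV_isCont)
  have inj: "inj_on \<theta> {-1<..<B}"
    by (rule linorder_inj_onI) (use mono in force)+
  define \<mu> where "\<mu> = inv_into {-1<..<B} \<theta>"
  have \<mu>\<theta>: "\<mu> (\<theta> x) = x" if "-1 < x" "x < B" for x
    unfolding \<mu>_def by (rule inv_into_f_f[OF inj]) (use that in auto)
  have ivt: "\<exists>z\<ge>x. z \<le> x' \<and> \<theta> z = s"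
    if "-1 < x" "x \<le> x'" "x' < B" "\<theta> x \<le> s" "s \<le> \<theta> x'" for x x' s
    using IVT'[of \<theta> x s x'] that cont by (force intro!: continuous_at_imp_continuous_on)
  \<comment> \<open>Comparison with the extremal case \<open>F z = L * (B - z)\<close>, whose time
    function is the left-hand side.\<close>
  have lower: "(ln B - ln (B - x)) / L \<le> \<theta> x" if "0 \<le> x" "x < B" for x
  proof -
    have "\<theta> 0 + ln (B - 0) / L \<le> \<theta> x + ln (B - x) / L"
    proof (rule DERIV_nonneg_imp_nondecreasing[OF that(1)])
      fix z assume z: "0 \<le> z" "z \<le> x"
      have "((\<lambda>x. \<theta> x + ln (B - x) / L) has_real_derivative 1 / F z + - 1 / (B - z) / L) (at z)"
        using z that by (intro DERIV_add der DERIV_cdivide) (auto intro!: derivative_eq_intros)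
      moreover have "1 / (L * (B - z)) \<le> 1 / F z"
        using z that pos[of z] bound[of z] L by (intro divide_left_mono mult_pos_pos) auto
      ultimately show "\<exists>D. ((\<lambda>x. \<theta> x + ln (B - x) / L) has_real_derivative D) (at z) \<and> 0 \<le> D"
        by (force simp: mult.commute)
    qed
    then show ?thesis by (simp add: \<theta>0 diff_divide_distrib)
  qed
  have surj: "\<exists>x. 0 \<le> x \<and> x < B \<and> \<theta> x = t" if "t \<ge> 0" for t
  proof -
    \<comment> \<open>The position at time \<open>t\<close> in the extremal case; by
      \<open>lower\<close>, the actual time needed to get there is at least
      \<open>t\<close>.\<close>
    define x where "x = B * (1 - exp (- L * t))"
    have x: "0 \<le> x" "x < B" using B L that by (auto simp: x_def)
    have "B - x = B * exp (- L * t)" by (simp add: x_def algebra_simps)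
    then have "(ln B - ln (B - x)) / L = t" using B L by (simp add: ln_mult)
    with lower[OF x] have "t \<le> \<theta> x" by simp
    with ivt[of 0 x t] x that \<theta>0 show ?thesis by force
  qed
  have \<mu>_ge: "0 \<le> \<mu> t \<and> \<mu> t < B" if "t \<ge> 0" for t
    using surj[OF that] \<mu>\<theta> by force
  have "(\<mu> has_real_derivative F (\<mu> t)) (at t)" if t: "t \<ge> 0" for t
  proof -
    obtain x where x: "0 \<le> x" "x < B" "\<theta> x = t" using surj[OF t] by blast
    define z where "z = (x + B) / 2"
    have z: "x < z" "z < B" using x by (auto simp: z_def)
    have "(\<mu> has_real_derivative inverse (1 / F x)) (at t)"
    proof (rule DERIV_inverse_function)
      show "(\<theta> has_real_derivative 1 / F x) (at (\<mu> t))"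
        using der[of x] x \<mu>\<theta>[of x] by simp
      show "1 / F x \<noteq> 0" using pos[of x] x by simp
      \<comment> \<open>A point left of 0 makes \<open>t = 0\<close> interior, so that the
        derivative is two-sided there as well.\<close>
      show "\<theta> (-1/2) < t" "t < \<theta> z" using mono[of "-1/2" x] mono[of x z] x z by auto
      show "\<theta> (\<mu> s) = s" if s: "\<theta> (-1/2) < s" "s < \<theta> z" for s
      proof -
        obtain w where "-1/2 \<le> w" "w \<le> z" "\<theta> w = s"
          using ivt[of "-1/2" z s] s x z by auto
        then show ?thesis using \<mu>\<theta>[of w] z by simp
      qed
      show "isCont \<mu> t"
      proof -
        have "isCont \<mu> (\<theta> x)"
          by (rule isCont_inverse_function2[of "-1/2" x z]) (use x z in \<open>auto intro: \<mu>\<theta> cont\<close>)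
        then show ?thesis using x by simp
      qed
    qed
    then show ?thesis using x \<mu>\<theta>[of x] by simp
  qed
  moreover have "\<mu> 0 = 0" using \<mu>\<theta>[of 0] \<theta>0 B by simp
  moreover have "\<mu> ` {0..} = {0..<B}"
  proof
    show "\<mu> ` {0..} \<subseteq> {0..<B}" using \<mu>_ge by (simp add: image_subset_iff)
    show "{0..<B} \<subseteq> \<mu> ` {0..}"
    proof
      fix x assume x: "x \<in> {0..<B}"
      then have "\<theta> x \<ge> 0" using mono[of 0 x] \<theta>0 by (cases "x = 0") auto
      with x \<mu>\<theta>[of x] show "x \<in> \<mu> ` {0..}" by (intro image_eqI[of _ _ "\<theta> x"]) auto
    qed
  qed
  ultimately show ?thesis by metis
qed

section \<open>Vectors, integrals and continuity\<close>

lemma sum_axis_component: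
  fixes \<iota> :: "nat \<Rightarrow> 'n::finite"
  assumes "bij_betw \<iota> I UNIV" "finite I" "c \<in> I"
  shows "(\<Sum>j\<in>I. x j *\<^sub>R axis (\<iota> j) (1::real)) $ \<iota> c = x c"
proof -
  have "x j * (axis (\<iota> j) 1 $ \<iota> c) = (if j = c then x c else 0)" if "j \<in> I" for j
    using inj_onD[OF bij_betw_imp_inj_on[OF assms(1)], of j c] that assms by (auto simp: axis_def)
  then show ?thesis using assms by simp
qed

lemma sum_axis_vec:
  fixes \<iota> :: "nat \<Rightarrow> 'n::finite" and m :: "real^'n"
  assumes "bij_betw \<iota> I UNIV" "finite I"
  shows "(\<Sum>j\<in>I. (m $ \<iota> j) *\<^sub>R axis (\<iota> j) (1::real)) = m"
proof (rule vec_eq_iff[THEN iffD2], rule allI)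
  fix i
  obtain c where "c \<in> I" "i = \<iota> c" using assms(1) unfolding bij_betw_def by auto
  then show "(\<Sum>j\<in>I. (m $ \<iota> j) *\<^sub>R axis (\<iota> j) (1::real)) $ i = m $ i"
    using sum_axis_component[OF assms] by simp
qed

text \<open>Turns the sign of a velocity into monotonicity of a coordinate. The interval is open at
  \<open>s\<close> because the sign is known only after the time supplied by
  \<open>last_nonneg_point\<close>.\<close>

lemma set_lebesgue_integral_mono_AE_interval:
  fixes g :: "real \<Rightarrow> real"
  assumes g: "set_integrable lebesgue {0..\<alpha>} g" and st: "0 \<le> s" "s \<le> t" "t \<le> \<alpha>"
    and nonneg: "AE r in lebesgue. r \<in> {s<..t} \<longrightarrow> 0 \<le> g r"
  shows "(LINT r:{0..s}|lebesgue. g r) \<le> (LINT r:{0..t}|lebesgue. g r)"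
proof -
  have "{0..t} = {0..s} \<union> {s<..t}" using st by auto
  moreover have "(LINT r:{0..s} \<union> {s<..t}|lebesgue. g r) =
      (LINT r:{0..s}|lebesgue. g r) + (LINT r:{s<..t}|lebesgue. g r)"
    by (rule set_integral_Un) (use st in \<open>auto intro!: set_integrable_subset[OF g]\<close>)
  moreover have "(LINT r:{s<..t}|lebesgue. g r) \<ge> 0"
    unfolding set_lebesgue_integral_def
    by (rule integral_nonneg_AE) (use nonneg in \<open>eventually_elim, auto simp: indicator_def\<close>)
  ultimately show ?thesis by simp
qed

lemma set_lebesgue_integral_antimono_AE_interval:
  fixes g :: "real \<Rightarrow> real"
  assumes g: "set_integrable lebesgue {0..\<alpha>} g" and st: "0 \<le> s" "s \<le> t" "t \<le> \<alpha>"
    and nonpos: "AE r in lebesgue. r \<in> {s<..t} \<longrightarrow> g r \<le> 0"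
  shows "(LINT r:{0..t}|lebesgue. g r) \<le> (LINT r:{0..s}|lebesgue. g r)"
proof -
  have "(LINT r:{0..s}|lebesgue. - g r) \<le> (LINT r:{0..t}|lebesgue. - g r)"
    using g nonpos st by (intro set_lebesgue_integral_mono_AE_interval) (auto simp: set_integrable_def)
  then show ?thesis by (simp add: set_lebesgue_integral_def)
qed

text \<open>Basis of the barrier arguments: after the last time at which \<open>g\<close> is
  nonnegative, its sign is fixed up to \<open>t\<close>. That time exists because the set of such
  times is compact.\<close>

lemma last_nonneg_point:
  fixes g :: "real \<Rightarrow> real"
  assumes g: "continuous_on {a..t} g" and "a \<le> t" "g a \<ge> 0" "g t < 0"
  obtains s where "a \<le> s" "s < t" "g s \<ge> 0" "\<And>r. s < r \<Longrightarrow> r \<le> t \<Longrightarrow> g r < 0"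
proof -
  define S where "S = {r \<in> {a..t}. 0 \<le> g r}"
  have "S = {a..t} \<inter> g -` {0..}" by (auto simp: S_def)
  then have "closed S" using continuous_closed_preimage[OF g] by simp
  moreover have "bounded S" by (rule bounded_subset[of "{a..t}"]) (auto simp: S_def)
  ultimately have "compact S" by (simp add: compact_eq_bounded_closed)
  moreover have "a \<in> S" using assms by (simp add: S_def)
  ultimately obtain s where s: "s \<in> S" "\<And>r. r \<in> S \<Longrightarrow> r \<le> s"
    using compact_attains_sup[of S] by auto
  show ?thesis
  proof
    show "a \<le> s" "g s \<ge> 0" using s by (auto simp: S_def)
    show "s < t" using s assms by (cases "s = t") (auto simp: S_def)
    show "g r < 0" if "s < r" "r \<le> t" for r
      using s(2)[of r] that \<open>a \<le> s\<close> by (force simp: S_def)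
  qed
qed

lemma continuous_on_Max_image:
  fixes g :: "'b \<Rightarrow> 'a::topological_space \<Rightarrow> real"
  assumes "finite I" "I \<noteq> {}" "\<And>c. c \<in> I \<Longrightarrow> continuous_on S (g c)"
  shows "continuous_on S (\<lambda>t. Max ((\<lambda>c. g c t) ` I))"
  using assms
proof (induction I rule: finite_ne_induct)
  case (insert c I)
  have "Max ((\<lambda>c. g c t) ` insert c I) = max (g c t) (Max ((\<lambda>c. g c t) ` I))" for t
    using insert.hyps by simp
  then show ?case using insert by (auto intro!: continuous_on_max)
qed simp

section \<open>Rates and their inverses\<close>

text \<open>Abstract properties of the exponential rates: each \<open>f c \<beta>\<close> is a
  reflected translate of one increasing map onto the numbers below 1. \<open>f_sublinear\<close>
  concerns class 1, which is active in every stage and so controls how the level decays to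
  0.\<close>

locale greedy_rates =
  fixes f :: "nat \<Rightarrow> real \<Rightarrow> real \<Rightarrow> real" and b :: "nat \<Rightarrow> real" and C :: nat
  assumes C_ge_1: "C \<ge> 1"
    and f_shift: "f c \<beta> z = f c (\<beta> - z) 0"
    and f_zero: "f c 0 0 = 0"
    and f_deriv: "c \<in> {1..C} \<Longrightarrow> \<exists>D>0. ((\<lambda>x. f c x 0) has_real_derivative D) (at x)"
    and f_range: "c \<in> {1..C} \<Longrightarrow> range (\<lambda>x. f c x 0) = {..<1}"
    and f_sublinear: "\<exists>L>0. \<forall>x\<ge>0. f 1 x 0 \<le> L * x"
    and b_nonneg: "c \<in> {1..C} \<Longrightarrow> b c \<ge> 0"
    and b_sum: "(\<Sum>c=1..C. b c) = 1"
    and ordered: "1 \<le> j \<Longrightarrow> j \<le> k \<Longrightarrow> k \<le> C \<Longrightarrow> f j (b j) 0 \<ge> f k (b k) 0"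
begin

text \<open>Keeps the index of the first class in the form \<open>1\<close>, as in
  \<open>y 1\<close> and \<open>h 1\<close>.\<close>

declare One_nat_def [simp del]

definition h :: "nat \<Rightarrow> real \<Rightarrow> real" where "h c = inv (\<lambda>x. f c x 0)"

definition y :: "nat \<Rightarrow> real" where "y c = f c (b c) 0"

lemma f_strict_mono: "c \<in> {1..C} \<Longrightarrow> x < z \<Longrightarrow> f c x 0 < f c z 0"
  using f_deriv by (intro DERIV_pos_imp_increasing[of x z "\<lambda>x. f c x 0"]) blast+

lemma f_less_iff: "c \<in> {1..C} \<Longrightarrow> f c x 0 < f c z 0 \<longleftrightarrow> x < z"
  using f_strict_mono[of c x z] f_strict_mono[of c z x] by (cases x z rule: linorder_cases) auto

lemma f_inj: "c \<in> {1..C} \<Longrightarrow> inj (\<lambda>x. f c x 0)"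
  by (rule linorder_injI) (use f_strict_mono in force)

lemma f_less_1: "c \<in> {1..C} \<Longrightarrow> f c \<beta> z < 1"
  using f_range[of c] by (subst f_shift) auto

lemma h_f: "c \<in> {1..C} \<Longrightarrow> h c (f c x 0) = x"
  unfolding h_def by (simp add: f_inj inv_f_f[of "\<lambda>x. f c x 0"])

lemma f_h: "c \<in> {1..C} \<Longrightarrow> v < 1 \<Longrightarrow> f c (h c v) 0 = v"
  unfolding h_def using f_range[of c] f_inv_into_f[of v "\<lambda>x. f c x 0" UNIV] by auto

lemma h_less_iff: "c \<in> {1..C} \<Longrightarrow> v < 1 \<Longrightarrow> w < 1 \<Longrightarrow> h c v < h c w \<longleftrightarrow> v < w"
  by (metis f_h f_less_iff)

lemma h_le_iff: "c \<in> {1..C} \<Longrightarrow> v < 1 \<Longrightarrow> w < 1 \<Longrightarrow> h c v \<le> h c w \<longleftrightarrow> v \<le> w"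
  using h_less_iff[of c w v] by auto

lemma h_zero: "c \<in> {1..C} \<Longrightarrow> h c 0 = 0"
  using h_f[of c 0] by (simp add: f_zero)

lemma h_y: "c \<in> {1..C} \<Longrightarrow> h c (y c) = b c"
  by (simp add: y_def h_f)

lemma y_less_1: "c \<in> {1..C} \<Longrightarrow> y c < 1"
  by (simp add: y_def f_less_1)

lemma y_nonneg: "c \<in> {1..C} \<Longrightarrow> y c \<ge> 0"
  using h_le_iff[of c 0 "y c"] y_less_1[of c] by (simp add: h_zero h_y b_nonneg)

lemma y_antimono: "1 \<le> j \<Longrightarrow> j \<le> k \<Longrightarrow> k \<le> C \<Longrightarrow> y k \<le> y j"
  unfolding y_def by (rule ordered)

text \<open>\<open>y 1\<close> is the largest initial rate; if it vanished, every \<open>b c\<close>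
  would equal \<open>h c 0 = 0\<close>, against total mass 1.\<close>

lemma y_1_pos: "y 1 > 0"
proof (rule ccontr)
  assume "\<not> y 1 > 0"
  then have "y c = 0" if "c \<in> {1..C}" for c
    using y_antimono[of 1 c] y_nonneg[of c] that by auto
  then have "b c = 0" if "c \<in> {1..C}" for c
    using h_y[of c] h_zero[of c] that by metis
  then show False using b_sum by simp
qed

lemma h_deriv:
  assumes c: "c \<in> {1..C}" and "v < 1"
  shows "\<exists>D>0. (h c has_real_derivative D) (at v)"
proof -
  obtain D where D: "D > 0" "((\<lambda>x. f c x 0) has_real_derivative D) (at (h c v))"
    using f_deriv[OF c] by blast
  have "isCont (h c) (f c (h c v) 0)"
  proof (rule isCont_inverse_function2[of "h c v - 1" "h c v" "h c v + 1" "h c" "\<lambda>x. f c x 0"])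
    show "isCont (\<lambda>x. f c x 0) x" for x
      using f_deriv[OF c, of x] DERIV_isCont by blast
  qed (simp_all add: h_f[OF c])
  then have "(h c has_real_derivative inverse D) (at v)"
    using assms D by (intro DERIV_inverse_function[of "\<lambda>x. f c x 0" _ _ _ "v - 1" 1]) (auto simp: f_h)
  with D show ?thesis by (intro exI[of _ "inverse D"]) simp
qed

lemma isCont_h: "c \<in> {1..C} \<Longrightarrow> v < 1 \<Longrightarrow> isCont (h c) v"
  using h_deriv[of c v] DERIV_isCont[of "h c"] by blast

lemma continuous_on_h: "c \<in> {1..C} \<Longrightarrow> A \<subseteq> {..<1} \<Longrightarrow> continuous_on A (h c)"
  using isCont_h by (intro continuous_at_imp_continuous_on) blast

lemma f_right_inverse: "c \<in> {1..C} \<Longrightarrow> v < 1 \<Longrightarrow> f c \<beta> (\<beta> - h c v) = v"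
  by (subst f_shift) (simp add: f_h)

lemma f_left_inverse: "c \<in> {1..C} \<Longrightarrow> \<beta> - h c (f c \<beta> z) = z"
  by (subst f_shift) (simp add: h_f)

lemma range_f:
  assumes "c \<in> {1..C}" shows "range (f c \<beta>) = {..<1}"
proof
  show "{..<1} \<subseteq> range (f c \<beta>)"
    using f_right_inverse[OF assms] by (intro subsetI) (metis lessThan_iff rangeI)
  show "range (f c \<beta>) \<subseteq> {..<1}"
    using f_less_1[OF assms] by auto
qed

lemma inv_f:
  assumes "c \<in> {1..C}" "v < 1"
  shows "inv (f c \<beta>) v = \<beta> - h c v"
  using f_left_inverse[OF assms(1)] f_right_inverse[OF assms] by (intro inv_f_eq) (metis injI)

text \<open>The recursion has no memory: by \<open>inv_f\<close>, subtracting the inverse cancels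
  the previous residual and leaves \<open>h c\<close> of the new level. At \<open>c = k\<close> both
  forms agree by \<open>h_y\<close>.\<close>

lemma residual_eq:
  assumes "1 \<le> k" "k \<le> C" "c \<in> {1..C}"
  shows "residual f b k c = (if c \<le> k then h c (y k) else b c)"
proof -
  obtain k' where k: "k = Suc k'" using assms by (cases k) auto
  show ?thesis
  proof (cases "k \<le> c")
    case True
    then show ?thesis using h_y[of c] assms by (auto simp: k)
  next
    case False
    then show ?thesis
      using inv_f[of c "y k"] y_less_1[of k] assms by (simp add: k y_def)
  qed
qed

section \<open>Level functions and the equations they drive\<close>

text \<open>Common form of the sum of inverses in \<open>agg_rate\<close> and of the total mass as a function of the
  level: \<open>- h 1\<close> up to a nonincreasing summand.\<close>

definition level_fun :: "(real \<Rightarrow> real) \<Rightarrow> bool" where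
  "level_fun P \<longleftrightarrow> continuous_on {..<1} P \<and>
     (\<forall>v w. v \<le> w \<longrightarrow> w < 1 \<longrightarrow> P w + h 1 w \<le> P v + h 1 v)"

lemma level_funD: "level_fun P \<Longrightarrow> v \<le> w \<Longrightarrow> w < 1 \<Longrightarrow> P w + h 1 w \<le> P v + h 1 v"
  unfolding level_fun_def by blast

lemma one_in: "1 \<in> {1..C}" using C_ge_1 by simp

lemma level_fun_less:
  assumes "level_fun P" "v < w" "w < 1" shows "P w < P v"
proof -
  have "h 1 v < h 1 w" using h_less_iff[OF one_in, of v w] assms by simp
  moreover have "P w + h 1 w \<le> P v + h 1 v" using level_funD[OF assms(1)] assms by simp
  ultimately show ?thesis by simp
qed

lemma level_fun_less_iff: "level_fun P \<Longrightarrow> v < 1 \<Longrightarrow> w < 1 \<Longrightarrow> P w < P v \<longleftrightarrow> v < w"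
  using level_fun_less[of P v w] level_fun_less[of P w v] by (cases v w rule: linorder_cases) auto

lemma level_fun_inj: "level_fun P \<Longrightarrow> inj_on P {..<1}"
  by (rule linorder_inj_onI) (use level_fun_less in force)+

lemma level_fun_surj:
  assumes P: "level_fun P" shows "\<exists>v<1. P v = x"
proof -
  \<comment> \<open>\<open>P + h 1\<close> is nonincreasing, so where \<open>h 1\<close> equals
    \<open>-K\<close> or \<open>K\<close>, the value of \<open>P\<close> lies at least
    \<open>K\<close> above or below \<open>P 0\<close>, which puts \<open>x\<close> in
    between.\<close>
  define K where "K = \<bar>P 0\<bar> + \<bar>x\<bar>"
  define v w where "v = f 1 (- K) 0" and "w = f 1 K 0"
  have vw: "h 1 v = - K" "h 1 w = K" "v < 1" "w < 1"
    by (simp_all add: v_def w_def h_f[OF one_in] f_less_1[OF one_in])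
  have K: "K \<ge> 0" by (simp add: K_def)
  have v0: "v \<le> 0" and w0: "0 \<le> w"
    using h_le_iff[OF one_in, of v 0] h_le_iff[OF one_in, of 0 w] vw K h_zero[OF one_in] by auto
  have "P 0 + h 1 0 \<le> P v + h 1 v" "P w + h 1 w \<le> P 0 + h 1 0"
    using level_funD[OF P v0] level_funD[OF P w0] vw by auto
  then have "x \<le> P v" "P w \<le> x" using vw h_zero[OF one_in] by (auto simp: K_def)
  moreover have "continuous_on {v..w} P"
    using P vw unfolding level_fun_def by (auto elim: continuous_on_subset)
  ultimately obtain z where "v \<le> z" "z \<le> w" "P z = x"
    using IVT2'[of P w x v] v0 w0 by auto
  with vw show ?thesis by (intro exI[of _ z]) auto
qed

abbreviation lev_inv :: "(real \<Rightarrow> real) \<Rightarrow> real \<Rightarrow> real" where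
  "lev_inv P \<equiv> inv_into {..<1} P"

lemma lev_inv_left: "level_fun P \<Longrightarrow> v < 1 \<Longrightarrow> lev_inv P (P v) = v"
  by (simp add: inv_into_f_f level_fun_inj)

lemma
  assumes "level_fun P"
  shows lev_inv_less_1: "lev_inv P x < 1" and lev_inv_right: "P (lev_inv P x) = x"
  using level_fun_surj[OF assms, of x] inv_into_into[of x P "{..<1}"] f_inv_into_f[of x P "{..<1}"]
  by auto

lemma lev_inv_less_iff: "level_fun P \<Longrightarrow> lev_inv P x < lev_inv P z \<longleftrightarrow> z < x"
  using level_fun_less_iff[of P "lev_inv P x" "lev_inv P z"] by (simp add: lev_inv_less_1 lev_inv_right)

lemma lev_inv_antimono: "level_fun P \<Longrightarrow> antimono (lev_inv P)"
  by (rule antimonoI) (metis lev_inv_less_iff not_less)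

lemma isCont_lev_inv:
  assumes P: "level_fun P" shows "isCont (lev_inv P) x"
proof -
  let ?v = "lev_inv P x"
  have v: "?v < 1" by (rule lev_inv_less_1[OF P])
  have "isCont (lev_inv P) (P ?v)"
  proof (rule isCont_inverse_function2[of "?v - 1" ?v "(?v + 1) / 2" "lev_inv P" P])
    have "isCont P z" if "z < 1" for z
      using P that unfolding level_fun_def by (simp add: continuous_on_eq_continuous_at)
    then show "isCont P z" if "?v - 1 \<le> z" "z \<le> (?v + 1) / 2" for z using that v by simp
    show "lev_inv P (P z) = z" if "?v - 1 \<le> z" "z \<le> (?v + 1) / 2" for z
      using that v by (intro lev_inv_left[OF P]) simp
  qed (use v in auto)
  then show ?thesis by (simp add: lev_inv_right[OF P])
qed

lemma lev_inv_pos_iff: "level_fun P \<Longrightarrow> 0 < lev_inv P x \<longleftrightarrow> x < P 0"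
  using level_fun_less_iff[of P 0 "lev_inv P x"] by (simp add: lev_inv_less_1 lev_inv_right)

text \<open>The linear bound comes from class 1: for \<open>v = lev_inv P x\<close> the rate
  satisfies \<open>v \<le> L * h 1 v\<close>, and \<open>level_funD\<close> between 0 and
  \<open>v\<close> gives \<open>h 1 v \<le> P 0 - x\<close>.\<close>

lemma level_ode:
  assumes P: "level_fun P" and P0: "P 0 > 0"
  shows "\<exists>\<mu>. \<mu> 0 = 0 \<and> (\<forall>t\<ge>0. (\<mu> has_real_derivative lev_inv P (\<mu> t)) (at t)) \<and>
    \<mu> ` {0..} = {0..<P 0}"
proof -
  obtain L where L: "L > 0" "\<And>x. x \<ge> 0 \<Longrightarrow> f 1 x 0 \<le> L * x" using f_sublinear by blast
  have "lev_inv P x \<le> L * (P 0 - x)" if "x < P 0" for x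
  proof -
    let ?v = "lev_inv P x"
    have v: "0 < ?v" "?v < 1" "P ?v = x"
      using that by (simp_all add: lev_inv_pos_iff lev_inv_less_1 lev_inv_right P)
    have "?v = f 1 (h 1 ?v) 0" using f_h[OF one_in] v by simp
    also have "\<dots> \<le> L * h 1 ?v"
      using v h_le_iff[OF one_in, of 0 ?v] by (intro L) (simp add: h_zero[OF one_in])
    also have "\<dots> \<le> L * (P 0 - x)"
    proof -
      have "P ?v + h 1 ?v \<le> P 0 + h 1 0" using level_funD[OF P, of 0 ?v] v by simp
      then show ?thesis using v L h_zero[OF one_in] by simp
    qed
    finally show ?thesis .
  qed
  then show ?thesis
    using L P0 isCont_lev_inv[OF P] lev_inv_pos_iff[OF P]
    by (intro scalar_ode_exists) (auto intro: continuous_at_imp_continuous_on)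
qed

text \<open>Meant for \<open>traj\<close>, which is an arbitrary choice: uniqueness identifies any
  solution with the one of \<open>level_ode\<close>, whose values stay below
  \<open>P 0\<close>.\<close>

lemma level_ode_pos:
  assumes P: "level_fun P" and P0: "P 0 > 0" and \<mu>0: "\<mu> 0 = 0"
    and \<mu>: "\<And>t. t \<ge> 0 \<Longrightarrow> (\<mu> has_real_derivative lev_inv P (\<mu> t)) (at t within {0..})"
    and t: "t \<ge> 0"
  shows "lev_inv P (\<mu> t) > 0"
proof -
  obtain \<mu>' where \<mu>': "\<mu>' 0 = 0"
    "\<And>t. t \<ge> 0 \<Longrightarrow> (\<mu>' has_real_derivative lev_inv P (\<mu>' t)) (at t)" "\<mu>' ` {0..} = {0..<P 0}"
    using level_ode[OF P P0] by auto
  have "\<mu> t = \<mu>' t"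
  proof (rule decreasing_ode_unique[where S = t and x = \<mu> and y = \<mu>', OF lev_inv_antimono[OF P]])
    show "(\<mu> has_real_derivative lev_inv P (\<mu> s)) (at s within {0..t})" if "s \<in> {0..t}" for s
      by (rule has_field_derivative_subset[OF \<mu>]) (use that in auto)
    show "(\<mu>' has_real_derivative lev_inv P (\<mu>' s)) (at s within {0..t})" if "s \<in> {0..t}" for s
      by (rule has_field_derivative_at_within[OF \<mu>'(2)]) (use that in auto)
  qed (use \<mu>0 \<mu>'(1) t in auto)
  moreover have "\<mu>' t < P 0" using \<mu>'(3) t by auto
  ultimately show ?thesis by (simp add: lev_inv_pos_iff P)
qed

section \<open>Total mass and level\<close>

text \<open>The first class enters uncut, which makes this a level function on all of
  \<open>{..<1}\<close>. Up to level \<open>y 1\<close> the cut would change nothing, see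
  \<open>total_eq\<close>.\<close>

definition total :: "real \<Rightarrow> real" where
  "total v = (b 1 - h 1 v) + (\<Sum>c=Suc 1..C. max 0 (b c - h c v))"

text \<open>The inverse of the aggregate rate of stage \<open>k\<close>. During that stage it
  differs from \<open>total\<close> by a constant.\<close>

definition lev :: "nat \<Rightarrow> real \<Rightarrow> real" where
  "lev k v = (\<Sum>c=1..k. residual f b k c - h c v)"

lemma level_fun_total: "level_fun total"
proof -
  have "continuous_on {..<1} total"
    unfolding total_def by (intro continuous_intros continuous_on_h one_in) auto
  moreover have "(\<Sum>c=Suc 1..C. max 0 (b c - h c w)) \<le> (\<Sum>c=Suc 1..C. max 0 (b c - h c v))"
    if "v \<le> w" "w < 1" for v w
    by (intro sum_mono max.mono) (use that h_le_iff[of _ v w] in auto)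
  ultimately show ?thesis unfolding level_fun_def total_def by auto
qed

lemma level_fun_lev:
  assumes k: "1 \<le> k" "k \<le> C" shows "level_fun (lev k)"
proof -
  have "continuous_on {..<1} (lev k)"
    unfolding lev_def by (intro continuous_intros continuous_on_h) (use k in auto)
  moreover have "lev k v + h 1 v = residual f b k 1 + (\<Sum>c=Suc 1..k. residual f b k c - h c v)" for v
    unfolding lev_def using k by (simp add: sum.atLeast_Suc_atMost[of 1])
  moreover have "(\<Sum>c=Suc 1..k. residual f b k c - h c w) \<le> (\<Sum>c=Suc 1..k. residual f b k c - h c v)"
    if "v \<le> w" "w < 1" for v w
    by (intro sum_mono diff_left_mono) (use that k h_le_iff[of _ v w] in auto)
  ultimately show ?thesis unfolding level_fun_def by auto
qed

lemma lev_eq: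
  assumes k: "1 \<le> k" "k \<le> C" shows "lev k v = (\<Sum>c=1..k. h c (y k) - h c v)"
  unfolding lev_def by (intro sum.cong) (use k residual_eq in auto)

lemma agg_rate_eq:
  assumes k: "1 \<le> k" "k \<le> C"
  shows "agg_rate f k (residual f b k) = lev_inv (lev k)"
proof -
  have "(\<Inter>c\<in>{1..k}. range (f c (residual f b k c))) = {..<1}"
    using k range_f by auto
  moreover have "(\<Sum>c=1..k. inv (f c (residual f b k c)) v) = lev k v" if "v < 1" for v
    unfolding lev_def using that k by (intro sum.cong) (auto simp: inv_f)
  \<comment> \<open>\<open>inv_into\<close> sees a function only on the given set, so agreement
    below 1 suffices.\<close>
  ultimately show ?thesis
    unfolding agg_rate_def inv_into_def by (auto cong: conj_cong)
qed

lemma inv_lev_inv: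
  assumes P: "level_fun P" and "v < 1"
  shows "inv (lev_inv P) v = P v"
proof (rule inv_f_eq)
  show "inj (lev_inv P)"
    by (rule inj_on_inverseI[of _ P]) (simp add: lev_inv_right[OF P])
qed (rule lev_inv_left[OF assms])

lemma lev_0_pos:
  assumes k: "1 \<le> k" "k \<le> C" and "y k > 0" shows "lev k 0 > 0"
  unfolding lev_eq[OF k]
proof (intro sum_pos)
  fix c assume c: "c \<in> {1..k}"
  then show "h c (y k) - h c 0 > 0"
    using h_less_iff[of c 0 "y k"] y_less_1[of k] assms by simp
qed (use k in auto)

section \<open>Trajectories of the single stages\<close>

abbreviation tr :: "nat \<Rightarrow> real \<Rightarrow> real" where
  "tr k \<equiv> traj f k (residual f b k)"

text \<open>\<open>y k > 0\<close> gives \<open>lev k 0 > 0\<close>, so \<open>level_ode\<close>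
  shows that the choice in \<open>traj\<close> is a genuine solution.\<close>

lemma traj:
  assumes k: "1 \<le> k" "k \<le> C" and "y k > 0"
  shows traj_0: "tr k 0 = 0"
    and traj_deriv: "t \<ge> 0 \<Longrightarrow> (tr k has_real_derivative lev_inv (lev k) (tr k t)) (at t within {0..})"
proof -
  have "\<exists>\<mu>. \<mu> 0 = 0 \<and> (\<forall>t\<ge>0. (\<mu> has_real_derivative lev_inv (lev k) (\<mu> t)) (at t within {0..}))"
    using level_ode[OF level_fun_lev[OF k] lev_0_pos[OF assms]] by (metis has_field_derivative_at_within)
  from someI_ex[OF this, folded agg_rate_eq[OF k], folded traj_def]
  show "tr k 0 = 0"
    and "t \<ge> 0 \<Longrightarrow> (tr k has_real_derivative lev_inv (lev k) (tr k t)) (at t within {0..})"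
    by (simp_all add: agg_rate_eq[OF k])
qed

lemma lev_inv_traj_pos:
  assumes k: "1 \<le> k" "k \<le> C" "y k > 0" and t: "t \<ge> 0"
  shows "lev_inv (lev k) (tr k t) > 0"
  by (rule level_ode_pos[OF level_fun_lev[OF k(1,2)] lev_0_pos[OF k] traj_0[OF k] traj_deriv[OF k] t])

text \<open>Positive speed makes the trajectory strictly increasing, so \<open>inv_into\<close> in
  \<open>hit_time\<close> returns the actual hitting time.\<close>

lemma traj_inj:
  assumes k: "1 \<le> k" "k \<le> C" "y k > 0" shows "inj_on (tr k) {0..}"
proof (rule linorder_inj_onI)
  fix s t :: real assume s: "s < t" "s \<in> {0..}" "t \<in> {0..}"
  have "tr k s < tr k t"
  proof (rule DERIV_pos_imp_increasing_open[OF s(1)])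
    show "continuous_on {s..t} (tr k)"
      by (rule continuous_on_subset[OF DERIV_continuous_on[OF traj_deriv[OF k]]]) (use s in auto)
    fix r assume r: "s < r" "r < t"
    have "at r within {0..} = at r"
      using r s by (intro at_within_interior) auto
    then show "\<exists>D. (tr k has_real_derivative D) (at r) \<and> 0 < D"
      using traj_deriv[OF k, of r] lev_inv_traj_pos[OF k, of r] r s by auto
  qed
  then show "tr k s \<noteq> tr k t" by simp
qed auto

section \<open>One mass function for all stages, and its level\<close>

definition mass :: "real \<Rightarrow> real" where
  "mass = (SOME \<mu>. \<mu> 0 = 0 \<and> (\<forall>t\<ge>0. (\<mu> has_real_derivative lev_inv total (\<mu> t)) (at t)) \<and>
     \<mu> ` {0..} = {0..<1})"

definition u :: "real \<Rightarrow> real" where "u t = lev_inv total (mass t)"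

lemma total_eq:
  assumes "v \<le> y 1"
  shows "total v = (\<Sum>c=1..C. max 0 (b c - h c v))"
proof -
  have "h 1 v \<le> h 1 (y 1)"
    using assms h_le_iff[OF one_in, of v "y 1"] y_less_1[OF one_in] by simp
  then have "max 0 (b 1 - h 1 v) = b 1 - h 1 v" using h_y[OF one_in] by simp
  then show ?thesis
    unfolding total_def by (subst sum.atLeast_Suc_atMost[OF C_ge_1]) simp
qed

text \<open>Classes after \<open>k\<close> have \<open>y c \<le> v\<close>, so their cut is 0; those
  up to \<open>k\<close> have \<open>v \<le> y c\<close>, so the cut is vacuous. This is where the
  ordering of the classes enters.\<close>

lemma total_stage:
  assumes k: "1 \<le> k" "k \<le> C" and v: "v \<le> y k" "k < C \<Longrightarrow> y (Suc k) \<le> v"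
  shows "total v = (\<Sum>c=1..k. b c - h c v)"
proof -
  have k': "k \<in> {1..C}" using k by simp
  have v1: "v < 1" using v y_less_1[OF k'] by simp
  have "v \<le> y 1" using v y_antimono[of 1 k] k by simp
  then have "total v = (\<Sum>c=1..C. max 0 (b c - h c v))" by (rule total_eq)
  also have "\<dots> = (\<Sum>c=1..k. b c - h c v)"
  proof (intro sum.mono_neutral_cong_right ballI)
    fix c assume c: "c \<in> {1..C} - {1..k}"
    then have "y c \<le> v" using y_antimono[of "Suc k" c] v by auto
    then have "b c \<le> h c v" using h_le_iff[of c "y c" v] h_y[of c] c v1 y_less_1[of c] by auto
    then show "max 0 (b c - h c v) = 0" by simp
  next
    fix c assume c: "c \<in> {1..k}"
    then have "v \<le> y c" using y_antimono[of c k] k v by auto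
    then have "h c v \<le> b c" using h_le_iff[of c v "y c"] h_y[of c] c k v1 y_less_1[of c] by auto
    then show "max 0 (b c - h c v) = b c - h c v" by simp
  qed (use k in auto)
  finally show ?thesis .
qed

lemma total_0: "total 0 = 1"
proof -
  have "max 0 (b c - h c 0) = b c" if "c \<in> {1..C}" for c
    using b_nonneg[OF that] h_zero[OF that] by simp
  then show ?thesis using total_eq[of 0] y_1_pos b_sum by simp
qed

lemma total_y_1: "total (y 1) = 0"
proof -
  have "max 0 (b c - h c (y 1)) = 0" if "c \<in> {1..C}" for c
    using h_le_iff[of c "y c" "y 1"] y_antimono[of 1 c] y_less_1[of 1] y_less_1[of c] h_y[of c] that C_ge_1
    by simp
  then show ?thesis using total_eq[of "y 1"] by simp
qed

lemma
  shows mass_0: "mass 0 = 0"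
    and mass_deriv: "t \<ge> 0 \<Longrightarrow> (mass has_real_derivative u t) (at t)"
    and mass_image: "mass ` {0..} = {0..<1}"
proof -
  have "\<exists>\<mu>. \<mu> 0 = 0 \<and> (\<forall>t\<ge>0. (\<mu> has_real_derivative lev_inv total (\<mu> t)) (at t)) \<and>
      \<mu> ` {0..} = {0..<1}"
    using level_ode[OF level_fun_total] by (simp add: total_0)
  from someI_ex[OF this, folded mass_def] show "mass 0 = 0"
    and "t \<ge> 0 \<Longrightarrow> (mass has_real_derivative u t) (at t)" and "mass ` {0..} = {0..<1}"
    by (simp_all add: u_def)
qed

lemma u_less_1: "u t < 1"
  unfolding u_def by (rule lev_inv_less_1[OF level_fun_total])

lemma total_u: "total (u t) = mass t"
  unfolding u_def by (rule lev_inv_right[OF level_fun_total])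

lemma u_0: "u 0 = y 1"
  using lev_inv_left[OF level_fun_total y_less_1[OF one_in]] by (simp add: u_def mass_0 total_y_1)

lemma u_pos: "t \<ge> 0 \<Longrightarrow> u t > 0"
  using mass_image lev_inv_pos_iff[OF level_fun_total, of "mass t"] total_0
  by (auto simp: u_def)

lemma mass_less: "0 \<le> s \<Longrightarrow> s < t \<Longrightarrow> mass s < mass t"
  using mass_deriv u_pos by (intro DERIV_pos_imp_increasing[of s t mass]) (meson order_trans)+

lemma u_less: "0 \<le> s \<Longrightarrow> s < t \<Longrightarrow> u t < u s"
  unfolding u_def by (simp add: lev_inv_less_iff[OF level_fun_total] mass_less)

lemma u_less_iff: "0 \<le> s \<Longrightarrow> 0 \<le> t \<Longrightarrow> u t < u s \<longleftrightarrow> s < t"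
  using u_less[of s t] u_less[of t s] by (cases s t rule: linorder_cases) auto

lemma u_le_iff: "0 \<le> s \<Longrightarrow> 0 \<le> t \<Longrightarrow> u t \<le> u s \<longleftrightarrow> s \<le> t"
  using u_less_iff[of t s] by auto

lemma isCont_u: "t \<ge> 0 \<Longrightarrow> isCont u t"
  unfolding u_def
  by (rule isCont_o2[OF DERIV_isCont[OF mass_deriv] isCont_lev_inv[OF level_fun_total]])

text \<open>The time at which the level is \<open>v\<close>, meaningful for
  \<open>0 < v \<le> y 1\<close>; level 0 is never reached.\<close>

definition reach :: "real \<Rightarrow> real" where "reach = inv_into {0..} u"

lemma
  assumes "0 < v" "v \<le> y 1"
  shows reach_nonneg: "reach v \<ge> 0" and u_reach: "u (reach v) = v"
proof -
  have v1: "v < 1" using assms y_less_1[OF one_in] by simp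
  have "total v < 1"
    using level_fun_less[OF level_fun_total assms(1) v1] total_0 by simp
  moreover have "total v \<ge> 0"
    unfolding total_eq[OF assms(2)] by (intro sum_nonneg) simp
  ultimately have "total v \<in> mass ` {0..}" using mass_image by simp
  then obtain t where t: "t \<ge> 0" "mass t = total v" by auto
  then have "u t = v" unfolding u_def using lev_inv_left[OF level_fun_total v1] by simp
  then have "v \<in> u ` {0..}" using t by auto
  from inv_into_into[OF this] f_inv_into_f[OF this]
  show "reach v \<ge> 0" "u (reach v) = v" by (auto simp: reach_def)
qed

lemma u_le_y_1: "t \<ge> 0 \<Longrightarrow> u t \<le> y 1"
  using u_le_iff[of 0 t] u_0 by simp

text \<open>While the level is between \<open>y (Suc k)\<close> and \<open>y k\<close>,
  \<open>total\<close> and \<open>lev k\<close> differ by a constant. Hence the mass function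
  restarted at \<open>reach (y k)\<close> solves the equation of stage \<open>k\<close>, and
  uniqueness equates it with \<open>tr k\<close>.\<close>

lemma traj_eq:
  assumes k: "1 \<le> k" "k \<le> C" "y k > 0" and t: "reach (y k) \<le> t"
    and next_le: "k < C \<Longrightarrow> y (Suc k) \<le> u t"
  shows "lev_inv (lev k) (tr k (t - reach (y k))) = u t"
proof -
  define r where "r = reach (y k)"
  have yk1: "y k \<le> y 1" using y_antimono[of 1 k] k by simp
  have r: "r \<ge> 0" "u r = y k" "r \<le> t"
    using reach_nonneg[OF k(3) yk1] u_reach[OF k(3) yk1] t by (auto simp: r_def)
  define X where "X s = mass (r + s) - mass r" for s
  have X: "lev k (u (r + s)) = X s" "lev_inv (lev k) (X s) = u (r + s)" if "s \<in> {0..t - r}" for s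
  proof -
    have s: "u t \<le> u (r + s)" "u (r + s) \<le> y k"
      using u_le_iff[of "r + s" t] u_le_iff[of r "r + s"] r that by auto
    have "total (u (r + s)) = (\<Sum>c=1..k. b c - h c (u (r + s)))"
      using s next_le k by (intro total_stage) auto
    moreover have "total (y k) = (\<Sum>c=1..k. b c - h c (y k))"
      using next_le k y_antimono[of k "Suc k"] by (intro total_stage) auto
    ultimately show "lev k (u (r + s)) = X s"
      unfolding X_def total_u[symmetric] r(2) lev_eq[OF k(1,2)] by (simp add: sum_subtractf)
    then show "lev_inv (lev k) (X s) = u (r + s)"
      using lev_inv_left[OF level_fun_lev[OF k(1,2)] u_less_1] by metis
  qed
  have "tr k (t - r) = X (t - r)"
  proof (rule decreasing_ode_unique[where x = "tr k" and y = X and S = "t - r",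
        OF lev_inv_antimono[OF level_fun_lev[OF k(1,2)]]])
    show "(tr k has_real_derivative lev_inv (lev k) (tr k s)) (at s within {0..t - r})"
      if "s \<in> {0..t - r}" for s
      by (rule has_field_derivative_subset[OF traj_deriv[OF k]]) (use that in auto)
    show "(X has_real_derivative lev_inv (lev k) (X s)) (at s within {0..t - r})"
      if "s \<in> {0..t - r}" for s
    proof (rule has_field_derivative_at_within)
      have "((\<lambda>s. mass (r + s)) has_real_derivative u (r + s)) (at s)"
        using mass_deriv[of "r + s"] r that DERIV_shift[of mass "u (r + s)" s r]
        by (simp add: add.commute)
      then show "(X has_real_derivative lev_inv (lev k) (X s)) (at s)"
        unfolding X(2)[OF that] unfolding X_def by (auto intro!: derivative_eq_intros)
    qed
  qed (use r traj_0[OF k] in \<open>auto simp: X_def\<close>)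
  then show ?thesis using X(2)[of "t - r"] r by (simp add: r_def)
qed

section \<open>Stages\<close>

lemma hit_time_nonneg: "hit_time \<mu> x \<ge> 0"
  using inv_into_into[of x \<mu> "{0..}"] by (auto simp: hit_time_def)

lemma y_le_y_1: "c \<in> {1..C} \<Longrightarrow> y c \<le> y 1"
  using y_antimono[of 1 c] by simp

lemma reach_mono:
  assumes "0 < v" "v \<le> w" "w \<le> y 1" shows "reach w \<le> reach v"
proof -
  have "0 < w" "v \<le> y 1" using assms by auto
  then show ?thesis
    using u_le_iff[of "reach w" "reach v"] assms by (simp add: reach_nonneg u_reach)
qed

lemma reach_y_1: "reach (y 1) = 0"
  using u_less[of 0 "reach (y 1)"] reach_nonneg[of "y 1"] u_reach[of "y 1"] y_1_pos u_0
  by (cases "reach (y 1) = 0") auto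

text \<open>In stage \<open>k\<close> the level falls from \<open>y k\<close> to
  \<open>y (Suc k)\<close>. If the latter is 0, the target is \<open>lev k 0\<close>, which is never
  attained because the level stays positive.\<close>

lemma hit_time_stage:
  assumes k: "1 \<le> k" "Suc k \<le> C" and yk: "y k > 0"
  shows "hit_time (tr k) (lev k (y (Suc k))) =
    (if y (Suc k) > 0 then ereal (reach (y (Suc k)) - reach (y k)) else \<infinity>)"
proof (cases "y (Suc k) > 0")
  case True
  define s where "s = reach (y (Suc k)) - reach (y k)"
  have le: "y (Suc k) \<le> y k" "y (Suc k) \<le> y 1" "y k \<le> y 1" using y_antimono k by auto
  have s: "s \<ge> 0" unfolding s_def using reach_mono[OF True le(1) le(3)] by simp
  have "lev_inv (lev k) (tr k s) = y (Suc k)"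
    unfolding s_def using traj_eq[of k "reach (y (Suc k))"] reach_mono[OF True le(1) le(3)]
      k yk u_reach[OF True le(2)] by simp
  then have tr: "tr k s = lev k (y (Suc k))"
    using lev_inv_right[OF level_fun_lev, of k "tr k s"] k by simp
  then have "lev k (y (Suc k)) \<in> tr k ` {0..}" using s by force
  moreover have "inv_into {0..} (tr k) (lev k (y (Suc k))) = s"
    using s k yk tr traj_inj[of k] by (intro inv_into_f_eq) auto
  ultimately show ?thesis using True by (simp add: hit_time_def s_def)
next
  case False
  then have y0: "y (Suc k) = 0" using y_nonneg[of "Suc k"] k by simp
  have "lev k 0 \<notin> tr k ` {0..}"
  proof
    assume "lev k 0 \<in> tr k ` {0..}"
    then obtain t where "t \<ge> 0" "tr k t = lev k 0" by auto
    then show False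
      using lev_inv_traj_pos[of k t] lev_inv_left[OF level_fun_lev, of k 0] k yk by simp
  qed
  then show ?thesis using y0 by (simp add: hit_time_def)
qed

text \<open>The hitting times telescope from \<open>reach (y 1) = 0\<close>, and the minimum with
  \<open>T\<close> commutes with adding nonnegative increments. A class with \<open>y k = 0\<close>
  is never reached and gets time \<open>T\<close>.\<close>

lemma stage_time_eq:
  assumes T: "T \<ge> 0" and "1 \<le> k" "k \<le> C"
  shows "stage_time f b T k = (if y k > 0 then min T (reach (y k)) else T)"
  using assms(2,3)
proof (induction k rule: nat_induct_at_least)
  case base
  show ?case using T reach_y_1 y_1_pos by (simp add: One_nat_def)
next
  case (Suc k)
  define x where "x = hit_time (tr k) (lev k (y (Suc k)))"
  have "inv (agg_rate f k (residual f b k)) (y (Suc k)) = lev k (y (Suc k))"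
    using Suc y_less_1[of "Suc k"] by (simp add: agg_rate_eq inv_lev_inv level_fun_lev)
  then have step: "stage_time f b T (Suc k) =
      real_of_ereal (min (ereal T) (ereal (stage_time f b T k) + x))"
    using Suc.hyps by (cases k) (auto simp: x_def y_def)
  show ?case
  proof (cases "y k > 0")
    case True
    then have x: "x = (if y (Suc k) > 0 then ereal (reach (y (Suc k)) - reach (y k)) else \<infinity>)"
      unfolding x_def using hit_time_stage Suc by simp
    have IH: "stage_time f b T k = min T (reach (y k))" using Suc True by simp
    show ?thesis
    proof (cases "y (Suc k) > 0")
      case yS: True
      have "reach (y k) \<le> reach (y (Suc k))"
        using reach_mono[OF yS] y_antimono[of k "Suc k"] y_antimono[of 1 k] Suc by simp
      then show ?thesis unfolding step x IH using yS by (simp add: min_def)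
    next
      case False
      then show ?thesis unfolding step x by simp
    qed
  next
    case False
    then have "y (Suc k) \<le> 0" using y_antimono[of k "Suc k"] Suc by simp
    moreover have "stage_time f b T k = T" using Suc False by simp
    \<comment> \<open>Nonnegativity of the hitting time already keeps the minimum at
      \<open>T\<close>.\<close>
    moreover have "ereal T \<le> ereal T + x" using hit_time_nonneg[of "tr k"]
      by (simp add: x_def ereal_le_add_self)
    ultimately show ?thesis unfolding step by (simp add: min_def)
  qed
qed

text \<open>Rewrites the stage index as the largest \<open>k\<close> with \<open>u t < y k\<close>;
  for \<open>t \<le> T\<close> the truncation at \<open>T\<close> is invisible.\<close>

lemma stage_time_less_iff:
  assumes "k \<in> {1..C}" and t: "0 < t" "t \<le> T"
  shows "stage_time f b T k < t \<longleftrightarrow> u t < y k"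
proof (cases "y k > 0")
  case True
  then have "stage_time f b T k = min T (reach (y k))" using assms by (simp add: stage_time_eq)
  then show ?thesis
    using u_less_iff[of "reach (y k)" t] True assms y_le_y_1[of k] reach_nonneg[of "y k"] u_reach[of "y k"]
    by auto
next
  case False
  then show ?thesis using stage_time_eq[of T k] u_pos[of t] assms by auto
qed

lemma stage_props:
  assumes t: "0 \<le> t" "t \<le> T" and k: "k = stage f b T C t"
  shows "1 \<le> k" "k \<le> C" "y k > 0" "reach (y k) \<le> t" "u t \<le> y k" "k < C \<Longrightarrow> y (Suc k) \<le> u t"
    and "stage_time f b T k = reach (y k)"
proof -
  have *: "1 \<le> k \<and> k \<le> C \<and> y k > 0 \<and> reach (y k) \<le> t \<and> u t \<le> y k \<and> (k < C \<longrightarrow> y (Suc k) \<le> u t)"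
  proof (cases "t = 0")
    \<comment> \<open>At time 0 no stage time is smaller, so the stage is 1 by convention; the weak
      inequalities cover this through \<open>u 0 = y 1\<close>.\<close>
    case True
    then have "k = 1" by (simp add: k stage_def)
    then show ?thesis using True u_0 y_1_pos C_ge_1 reach_y_1 y_antimono[of 1 "Suc 1"] by simp
  next
    case False
    then have t0: "t > 0" using t by simp
    have S: "{j \<in> {1..C}. t > stage_time f b T j} = {j \<in> {1..C}. u t < y j}"
      using stage_time_less_iff t0 t by blast
    have kM: "k = Max {j \<in> {1..C}. u t < y j}" using False k S by (simp add: stage_def)
    have "1 \<in> {j \<in> {1..C}. u t < y j}" using u_less[of 0 t] u_0 t0 C_ge_1 by simp
    then have "k \<in> {j \<in> {1..C}. u t < y j}" unfolding kM by (intro Max_in) auto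
    then have k': "1 \<le> k" "k \<le> C" "u t < y k" by auto
    have "\<not> u t < y (Suc k)" if "k < C"
    proof
      assume "u t < y (Suc k)"
      then have "Suc k \<in> {j \<in> {1..C}. u t < y j}" using that by simp
      then have "Suc k \<le> Max {j \<in> {1..C}. u t < y j}" by (intro Max_ge) auto
      then show False using kM by simp
    qed
    moreover have "y k > 0" using k' u_pos[of t] t by simp
    moreover have "reach (y k) \<le> t"
      using u_le_iff[of "reach (y k)" t] \<open>y k > 0\<close> k' t y_le_y_1[of k] reach_nonneg[of "y k"] u_reach[of "y k"]
      by simp
    ultimately show ?thesis using k' by auto
  qed
  then show "1 \<le> k" "k \<le> C" "y k > 0" "reach (y k) \<le> t" "u t \<le> y k" "k < C \<Longrightarrow> y (Suc k) \<le> u t"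
    by auto
  show "stage_time f b T k = reach (y k)" using * t by (subst stage_time_eq) auto
qed

lemma mstar_eq:
  assumes t: "0 \<le> t" "t \<le> T" and c: "c \<in> {1..C}"
  shows "mstar f b T C c t = max 0 (b c - h c (u t))"
proof -
  define k where "k = stage f b T C t"
  note k = stage_props[OF t k_def]
  have r: "agg_rate f k (residual f b k) (tr k (t - stage_time f b T k)) = u t"
    unfolding agg_rate_eq[OF k(1,2)] k(7) by (rule traj_eq[OF k(1-4,6)])
  have "mstar f b T C c t = (b c - residual f b k c) + max (residual f b k c - h c (u t)) 0"
    unfolding mstar_def Let_def k_def[symmetric] r inv_f[OF c u_less_1] ..
  also have "\<dots> = max 0 (b c - h c (u t))"
  \<comment> \<open>For \<open>c \<le> k\<close> both positive parts are vacuous and the residual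
    cancels; for \<open>c > k\<close> the residual is \<open>b c\<close> and the first summand
    vanishes.\<close>
  proof (cases "c \<le> k")
    case True
    then have "h c (u t) \<le> h c (y k)" "h c (y k) \<le> h c (y c)"
      using h_le_iff[OF c] u_less_1 k y_less_1[of k] y_less_1[of c] y_antimono[of c k] c by auto
    then show ?thesis using residual_eq[OF k(1,2) c] True h_y[OF c] by simp
  qed (use residual_eq[OF k(1,2) c] in auto)
  finally show ?thesis .
qed

section \<open>The trajectory solves the inclusion\<close>

text \<open>Near \<open>v\<close> the cut function is either \<open>b c - h c v\<close> or
  constantly 0; only at \<open>v = y c\<close> do the one-sided derivatives differ.\<close>

lemma cut_deriv:
  assumes c: "c \<in> {1..C}" and v: "v < 1" "v \<noteq> y c"
  shows "\<exists>D\<le>0. (y c < v \<longrightarrow> D = 0) \<and> (v < y c \<longrightarrow> D < 0) \<and>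
    ((\<lambda>v. max 0 (b c - h c v)) has_real_derivative D) (at v)"
proof (cases "v < y c")
  case True
  obtain D where D: "D > 0" "(h c has_real_derivative D) (at v)" using h_deriv[OF c v(1)] by blast
  have "((\<lambda>v. b c - h c v) has_real_derivative - D) (at v)"
    using D by (auto intro!: derivative_eq_intros)
  then have "((\<lambda>v. max 0 (b c - h c v)) has_real_derivative - D) (at v)"
  proof (rule has_field_derivative_transform_within_open[where S = "{..<y c}"])
    fix w assume "w \<in> {..<y c}"
    then have "h c w < b c" using h_less_iff[OF c, of w "y c"] y_less_1[OF c] h_y[OF c] by simp
    then show "b c - h c w = max 0 (b c - h c w)" by simp
  qed (use True in auto)
  then show ?thesis using D True by (intro exI[of _ "- D"]) auto
next
  case False
  have "((\<lambda>v. 0) has_real_derivative 0) (at v)" by simp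
  then have "((\<lambda>v. max 0 (b c - h c v)) has_real_derivative 0) (at v)"
  proof (rule has_field_derivative_transform_within_open[where S = "{y c<..<1}"])
    fix w assume "w \<in> {y c<..<1}"
    then have "b c < h c w" using h_less_iff[OF c, of "y c" w] y_less_1[OF c] h_y[OF c] by simp
    then show "0 = max 0 (b c - h c w)" by simp
  qed (use False v in auto)
  then show ?thesis using False v by (intro exI[of _ 0]) auto
qed

text \<open>Times at which the level crosses some \<open>y c\<close>. If \<open>y c = 0\<close>,
  \<open>reach\<close> returns an arbitrary number, which only adds a point to a finite exceptional
  set.\<close>

definition kinks :: "real set" where "kinks = (\<lambda>c. reach (y c)) ` {1..C}"

lemma not_kink:
  assumes "t \<ge> 0" "t \<notin> kinks" "c \<in> {1..C}" shows "u t \<noteq> y c"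
proof
  assume *: "u t = y c"
  then have "y c > 0" using u_pos[OF assms(1)] by simp
  then have "u (reach (y c)) = u t" "reach (y c) \<ge> 0"
    using * u_reach reach_nonneg y_le_y_1 assms by auto
  then have "reach (y c) = t"
    using u_less[of t "reach (y c)"] u_less[of "reach (y c)" t] assms(1)
    by (cases t "reach (y c)" rule: linorder_cases) auto
  then show False using assms unfolding kinks_def by auto
qed

lemma zero_kink: "0 \<in> kinks"
  unfolding kinks_def using reach_y_1 one_in by force

lemma u_deriv:
  assumes t: "t > 0" "t \<notin> kinks"
  shows "\<exists>D\<le>0. (u has_real_derivative D) (at t)"
proof -
  have "\<forall>c\<in>{1..C}. \<exists>D\<le>0. ((\<lambda>v. max 0 (b c - h c v)) has_real_derivative D) (at (u t))"
    using cut_deriv[OF _ u_less_1 not_kink[OF less_imp_le[OF t(1)] t(2)]] by blast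
  then obtain D where D: "\<And>c. c \<in> {1..C} \<Longrightarrow> D c \<le> 0"
    "\<And>c. c \<in> {1..C} \<Longrightarrow> ((\<lambda>v. max 0 (b c - h c v)) has_real_derivative D c) (at (u t))"
    by metis
  obtain D1 where D1: "D1 > 0" "(h 1 has_real_derivative D1) (at (u t))"
    using h_deriv[OF one_in u_less_1] by blast
  \<comment> \<open>The derivative of \<open>total\<close>; the uncut term of class 1 alone makes it
    strictly negative, so the inverse is differentiable.\<close>
  define K where "K = - D1 + (\<Sum>c=Suc 1..C. D c)"
  have K: "K < 0" using D1 sum_nonpos[of "{Suc 1..C}" D] D(1) by (simp add: K_def)
  have "((\<lambda>v. \<Sum>c=Suc 1..C. max 0 (b c - h c v)) has_real_derivative (\<Sum>c=Suc 1..C. D c)) (at (u t))"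
    by (intro DERIV_sum D(2)) simp
  from DERIV_add[OF DERIV_diff[OF DERIV_const D1(2)] this]
  have "(total has_real_derivative K) (at (u t))"
    unfolding total_def[abs_def] K_def by simp
  then have "(lev_inv total has_real_derivative inverse K) (at (mass t))"
    using K isCont_lev_inv[OF level_fun_total] lev_inv_right[OF level_fun_total]
    by (intro DERIV_inverse_function[of total K "lev_inv total" "mass t" "mass t - 1" "mass t + 1"])
      (auto simp: u_def)
  then have "(u has_real_derivative inverse K * u t) (at t)"
    unfolding u_def[abs_def] using mass_deriv[of t] t
    by (intro DERIV_chain2[where f = "lev_inv total"]) (auto simp: u_def)
  then show ?thesis
    using K u_pos[of t] t by (intro exI[of _ "inverse K * u t"]) (auto intro: mult_nonpos_nonneg)
qed

definition sol :: "nat \<Rightarrow> real \<Rightarrow> real" where "sol c t = max 0 (b c - h c (u t))"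

lemma sol_deriv:
  assumes t: "t > 0" "t \<notin> kinks" and c: "c \<in> {1..C}"
  shows "(sol c has_real_derivative deriv (sol c) t) (at t)" "deriv (sol c) t \<ge> 0"
    "y c < u t \<Longrightarrow> deriv (sol c) t = 0"
proof -
  obtain D where D: "D \<le> 0" "y c < u t \<longrightarrow> D = 0"
    "((\<lambda>v. max 0 (b c - h c v)) has_real_derivative D) (at (u t))"
    using cut_deriv[OF c u_less_1 not_kink[OF less_imp_le[OF t(1)] t(2) c]] by blast
  obtain D' where D': "D' \<le> 0" "(u has_real_derivative D') (at t)"
    using u_deriv[OF t] by blast
  have *: "(sol c has_real_derivative D * D') (at t)"
    unfolding sol_def[abs_def] by (rule DERIV_chain2[OF D(3) D'(2)])
  then have eq: "deriv (sol c) t = D * D'" by (rule DERIV_imp_deriv)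
  show "(sol c has_real_derivative deriv (sol c) t) (at t)" "deriv (sol c) t \<ge> 0"
    "y c < u t \<Longrightarrow> deriv (sol c) t = 0"
    using * D D' by (auto simp: eq mult_nonpos_nonpos)
qed

lemma sum_sol: "t \<ge> 0 \<Longrightarrow> (\<Sum>c=1..C. sol c t) = mass t"
  unfolding sol_def using total_eq[OF u_le_y_1] total_u by metis

lemma sum_deriv_sol:
  assumes t: "t > 0" "t \<notin> kinks"
  shows "(\<Sum>c=1..C. deriv (sol c) t) = u t"
proof -
  have "((\<lambda>t. \<Sum>c=1..C. sol c t) has_real_derivative (\<Sum>c=1..C. deriv (sol c) t)) (at t)"
    by (intro DERIV_sum sol_deriv t)
  then have "(mass has_real_derivative (\<Sum>c=1..C. deriv (sol c) t)) (at t)"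
    by (rule has_field_derivative_transform_within_open[where S = "{0<..}"])
      (use t sum_sol in auto)
  then show ?thesis using mass_deriv[of t] t DERIV_unique by force
qed

lemma sol_0: "c \<in> {1..C} \<Longrightarrow> sol c 0 = 0"
  using h_le_iff[of c "y c" "y 1"] y_le_y_1[of c] y_less_1[of c] y_less_1[OF one_in] h_y[of c]
  by (simp add: sol_def u_0)

lemma continuous_on_sol: "c \<in> {1..C} \<Longrightarrow> continuous_on {0..} (sol c)"
  unfolding sol_def[abs_def]
  by (intro continuous_at_imp_continuous_on ballI continuous_intros
      isCont_o2[OF isCont_u isCont_h] u_less_1) auto

text \<open>Dividing by \<open>W\<close> turns the velocities into convex weights on the generators
  \<open>W *\<^sub>R axis (\<iota> c) 1\<close> of the active classes.\<close>

lemma greedy_fieldI: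
  fixes \<iota> :: "nat \<Rightarrow> 'n::finite"
  assumes D: "\<And>c. c \<in> {1..C} \<Longrightarrow> D c \<ge> 0" "(\<Sum>c=1..C. D c) = W" "W > 0"
    and le: "\<And>c. c \<in> {1..C} \<Longrightarrow> f c (b c) (m $ \<iota> c) \<le> W"
    and eq: "\<And>c. c \<in> {1..C} \<Longrightarrow> D c \<noteq> 0 \<Longrightarrow> f c (b c) (m $ \<iota> c) = W"
  shows "(\<Sum>c=1..C. D c *\<^sub>R axis (\<iota> c) 1) \<in> greedy_field f b C \<iota> m"
proof -
  define A where "A = {c \<in> {1..C}. D c \<noteq> 0}"
  have "(\<Sum>c\<in>A. (D c / W) *\<^sub>R (W *\<^sub>R axis (\<iota> c) 1)) \<in> greedy_field f b C \<iota> m"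
  proof (rule convex_sum)
    show "(\<Sum>c\<in>A. D c / W) = 1"
    proof -
      have "(\<Sum>c\<in>A. D c) = W"
        unfolding D(2)[symmetric] A_def by (intro sum.mono_neutral_left) auto
      then show ?thesis using D(3) by (simp add: sum_divide_distrib[symmetric])
    qed
    fix c assume c: "c \<in> A"
    then show "0 \<le> D c / W" using D by (simp add: A_def)
    have v: "f c (b c) (m $ \<iota> c) = W" using eq c by (simp add: A_def)
    then have "is_arg_max (\<lambda>k. f k (b k) (m $ \<iota> k)) (\<lambda>k. k \<in> {1..C}) c"
      using c le unfolding is_arg_max_def A_def by (auto simp: not_less)
    then show "W *\<^sub>R axis (\<iota> c) 1 \<in> greedy_field f b C \<iota> m"
      unfolding greedy_field_def using v by (intro hull_inc) blast
  qed (auto simp: A_def greedy_field_def)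
  also have "(\<Sum>c\<in>A. (D c / W) *\<^sub>R (W *\<^sub>R axis (\<iota> c) 1)) = (\<Sum>c=1..C. D c *\<^sub>R (axis (\<iota> c) 1 :: real^'n))"
    using D(3) by (intro sum.mono_neutral_cong_left) (auto simp: A_def)
  finally show ?thesis .
qed

lemma sol_incl_solution:
  fixes \<iota> :: "nat \<Rightarrow> 'n::finite"
  assumes \<iota>: "bij_betw \<iota> {1..C} UNIV"
  shows "incl_solution (greedy_field f b C \<iota>) \<alpha> (\<lambda>t. \<Sum>c=1..C. sol c t *\<^sub>R axis (\<iota> c) 1)"
proof -
  define m :: "real \<Rightarrow> real^'n" where "m t = (\<Sum>c=1..C. sol c t *\<^sub>R axis (\<iota> c) 1)" for t
  \<comment> \<open>The value 0 at the kinks keeps \<open>\<phi>\<close> nonnegative everywhere, so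
    that integrability yields absolute integrability below.\<close>
  define \<phi> :: "real \<Rightarrow> real^'n" where
    "\<phi> t = (if t \<in> kinks then 0 else \<Sum>c=1..C. deriv (sol c) t *\<^sub>R axis (\<iota> c) 1)" for t
  have fin: "finite kinks" by (simp add: kinks_def)
  have m0: "m 0 = 0" by (simp add: m_def sol_0)
  have int: "(\<phi> has_integral m t) {0..t}" if "t \<ge> 0" for t
  proof -
    have "(\<phi> has_integral m t - m 0) {0..t}"
    proof (rule fundamental_theorem_of_calculus_interior_strong[OF fin that])
      show "continuous_on {0..t} m"
        unfolding m_def by (intro continuous_intros continuous_on_subset[OF continuous_on_sol]) auto
      show "(m has_vector_derivative \<phi> s) (at s)" if s: "s \<in> {0<..<t} - kinks" for s
      proof -
        have "((\<lambda>t. sol c t *\<^sub>R axis (\<iota> c) 1 :: real^'n) has_vector_derivative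
            deriv (sol c) s *\<^sub>R axis (\<iota> c) 1) (at s)" if "c \<in> {1..C}" for c
          using has_vector_derivative_scaleR[OF sol_deriv(1)[of s c] has_vector_derivative_const] s that
          by simp
        then show ?thesis
          unfolding m_def \<phi>_def using s by (auto intro!: has_vector_derivative_sum)
      qed
    qed
    then show ?thesis by (simp add: m0)
  qed
  have abs: "\<phi> absolutely_integrable_on {0..t}" if "t \<ge> 0" for t
  proof (rule nonnegative_absolutely_integrable)
    show "\<phi> integrable_on {0..t}" using int[OF that] by blast
    fix s and e :: "real^'n" assume s: "s \<in> {0..t}" and "e \<in> Basis"
    then obtain i where e: "e = axis i 1" by (auto simp: Basis_vec_def)
    have "i \<in> \<iota> ` {1..C}" using bij_betw_imp_surj_on[OF \<iota>] by simp
    then obtain c where c: "c \<in> {1..C}" "i = \<iota> c" by blast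
    show "0 \<le> \<phi> s \<bullet> e"
    proof (cases "s \<in> kinks")
      case False
      then have "s > 0" using s zero_kink by (cases "s = 0") auto
      then show ?thesis
        using False sum_axis_component[OF \<iota> _ c(1)] sol_deriv(2)[of s c] c
        by (simp add: \<phi>_def e inner_axis)
    qed (simp add: \<phi>_def)
  qed
  have "set_integrable lebesgue {0..\<alpha>} \<phi>"
    using abs[of \<alpha>] by (cases "\<alpha> \<ge> 0") (auto simp: set_integrable_def)
  moreover have "m t = (LINT s:{0..t}|lebesgue. \<phi> s)" if "t \<in> {0..\<alpha>}" for t
    using set_lebesgue_integral_eq_integral(2)[OF abs[of t]] int[of t] that by (auto simp: integral_unique)
  moreover have "AE t in lebesgue. t \<in> {0..\<alpha>} \<longrightarrow> \<phi> t \<in> greedy_field f b C \<iota> (m t)"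
  proof -
    have "AE t in lebesgue. t \<notin> kinks"
      using fin by (intro AE_not_in) (simp add: negligible_iff_null_sets[symmetric] negligible_finite)
    then show ?thesis
    proof (eventually_elim, intro impI)
      fix t assume t: "t \<notin> kinks" "t \<in> {0..\<alpha>}"
      then have t0: "t > 0" using zero_kink by (cases "t = 0") auto
      have mc: "m t $ \<iota> c = sol c t" if "c \<in> {1..C}" for c
        unfolding m_def using sum_axis_component[OF \<iota> _ that] by simp
      \<comment> \<open>This is the minimum of \<open>u t\<close> and \<open>y c\<close>: a class
        that has not moved keeps its initial rate, at most the common level.\<close>
      have val: "f c (b c) (sol c t) = (if u t < y c then u t else y c)" if c: "c \<in> {1..C}" for c
      proof (cases "u t < y c")
        case True
        then have "h c (u t) < b c" using h_less_iff[OF c, of "u t" "y c"] u_less_1 y_less_1[OF c] h_y[OF c] by simp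
        then show ?thesis using True f_right_inverse[OF c u_less_1] by (simp add: sol_def)
      next
        case False
        then have "b c \<le> h c (u t)" using h_le_iff[OF c, of "y c" "u t"] u_less_1 y_less_1[OF c] h_y[OF c] by simp
        then show ?thesis using False by (simp add: sol_def y_def)
      qed
      have "(\<Sum>c=1..C. deriv (sol c) t *\<^sub>R axis (\<iota> c) 1) \<in> greedy_field f b C \<iota> (m t)"
      proof (rule greedy_fieldI[where W = "u t"])
        show "f c (b c) (m t $ \<iota> c) = u t" if c: "c \<in> {1..C}" "deriv (sol c) t \<noteq> 0" for c
          using sol_deriv(3)[OF t0 t(1) c(1)] not_kink[of t c] t0 t(1) c val mc by force
      qed (use sol_deriv(2) sum_deriv_sol u_pos t t0 mc val in auto)
      then show "\<phi> t \<in> greedy_field f b C \<iota> (m t)" using t by (simp add: \<phi>_def)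
    qed
  qed
  ultimately show ?thesis unfolding incl_solution_def m_def[symmetric] by blast
qed

section \<open>Uniqueness\<close>

text \<open>The four properties define a convex set containing every generator, hence the hull. Both
  signs of \<open>W\<close> are covered because the sign along an arbitrary solution is not known
  beforehand.\<close>

lemma greedy_fieldD:
  fixes \<iota> :: "nat \<Rightarrow> 'n::finite" and v m :: "real^'n"
  assumes \<iota>: "bij_betw \<iota> {1..C} UNIV" and v: "v \<in> greedy_field f b C \<iota> m"
    and W: "W = Max ((\<lambda>c. f c (b c) (m $ \<iota> c)) ` {1..C})"
  shows "c \<in> {1..C} \<Longrightarrow> f c (b c) (m $ \<iota> c) < W \<Longrightarrow> v $ \<iota> c = 0"
    and "c \<in> {1..C} \<Longrightarrow> 0 \<le> W \<Longrightarrow> 0 \<le> v $ \<iota> c"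
    and "c \<in> {1..C} \<Longrightarrow> W \<le> 0 \<Longrightarrow> v $ \<iota> c \<le> 0"
    and "(\<Sum>c=1..C. v $ \<iota> c) = W"
proof -
  define K :: "(real^'n) set" where "K = {v. (\<forall>c\<in>{1..C}. (f c (b c) (m $ \<iota> c) < W \<longrightarrow> v $ \<iota> c = 0) \<and>
    (0 \<le> W \<longrightarrow> 0 \<le> v $ \<iota> c) \<and> (W \<le> 0 \<longrightarrow> v $ \<iota> c \<le> 0)) \<and> (\<Sum>c=1..C. v $ \<iota> c) = W}"
  have "convex K"
  proof (rule convexI)
    fix x y :: "real^'n" and r s :: real
    assume xy: "x \<in> K" "y \<in> K" and rs: "0 \<le> r" "0 \<le> s" "r + s = 1"
    have "(\<Sum>c=1..C. (r *\<^sub>R x + s *\<^sub>R y) $ \<iota> c) = r * W + s * W"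
      using xy by (simp add: K_def sum.distrib sum_distrib_left[symmetric])
    also have "\<dots> = W" using rs by (metis distrib_right mult_1)
    finally show "r *\<^sub>R x + s *\<^sub>R y \<in> K"
      using xy rs unfolding K_def
      by (auto intro!: add_nonneg_nonneg add_nonpos_nonpos mult_nonneg_nonpos)
  qed
  moreover have "f c (b c) (m $ \<iota> c) *\<^sub>R axis (\<iota> c) 1 \<in> K"
    if c: "is_arg_max (\<lambda>k. f k (b k) (m $ \<iota> k)) (\<lambda>k. k \<in> {1..C}) c" for c
  proof -
    have c': "c \<in> {1..C}" and "\<And>j. j \<in> {1..C} \<Longrightarrow> f j (b j) (m $ \<iota> j) \<le> f c (b c) (m $ \<iota> c)"
      using c by (auto simp: is_arg_max_def not_less)
    then have Wc: "f c (b c) (m $ \<iota> c) = W"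
      unfolding W by (intro Max_eqI[symmetric]) auto
    have ax: "axis (\<iota> c) (1::real) $ \<iota> j = (if j = c then 1 else 0)" if "j \<in> {1..C}" for j
      using inj_onD[OF bij_betw_imp_inj_on[OF \<iota>], of j c] that c' by (auto simp: axis_def)
    show ?thesis
      unfolding K_def Wc using c' Wc by (auto simp: ax sum_distrib_left[symmetric])
  qed
  ultimately have "greedy_field f b C \<iota> m \<subseteq> K"
    unfolding greedy_field_def by (intro hull_minimal) auto
  with v have "v \<in> K" by blast
  then show "c \<in> {1..C} \<Longrightarrow> f c (b c) (m $ \<iota> c) < W \<Longrightarrow> v $ \<iota> c = 0"
    and "c \<in> {1..C} \<Longrightarrow> 0 \<le> W \<Longrightarrow> 0 \<le> v $ \<iota> c"
    and "c \<in> {1..C} \<Longrightarrow> W \<le> 0 \<Longrightarrow> v $ \<iota> c \<le> 0"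
    and "(\<Sum>c=1..C. v $ \<iota> c) = W"
    by (auto simp: K_def)
qed

text \<open>An arbitrary solution is first forced into the one-parameter form: the level
  \<open>W\<close> is nonnegative and nonincreasing, and inactive classes have not moved. The mass
  then solves the scalar equation of \<open>mass\<close>.\<close>

lemma incl_solution_unique:
  fixes \<iota> :: "nat \<Rightarrow> 'n::finite"
  assumes \<iota>: "bij_betw \<iota> {1..C} UNIV"
    and sol: "incl_solution (greedy_field f b C \<iota>) \<alpha> m" and t: "t \<in> {0..\<alpha>}" and c: "c \<in> {1..C}"
  shows "m t $ \<iota> c = sol c t"
proof -
  obtain \<phi> where \<phi>: "set_integrable lebesgue {0..\<alpha>} \<phi>"
    and m: "\<And>t. t \<in> {0..\<alpha>} \<Longrightarrow> m t = (LINT s:{0..t}|lebesgue. \<phi> s)"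
    and AE: "AE t in lebesgue. t \<in> {0..\<alpha>} \<longrightarrow> \<phi> t \<in> greedy_field f b C \<iota> (m t)"
    using sol unfolding incl_solution_def by blast
  define X where "X c t = m t $ \<iota> c" for c t
  define val where "val c t = f c (b c) (X c t)" for c t
  define W where "W t = Max ((\<lambda>c. val c t) ` {1..C})" for t
  have ne: "{1..C} \<noteq> {}" using C_ge_1 by simp
  have \<phi>_sub: "set_integrable lebesgue {0..t} \<phi>" if "t \<in> {0..\<alpha>}" for t
    by (rule set_integrable_subset[OF \<phi>]) (use that in auto)
  have \<phi>c: "set_integrable lebesgue {0..t} (\<lambda>s. \<phi> s $ i)" if "t \<in> {0..\<alpha>}" for t i
    using absolutely_integrable_linear[OF \<phi>_sub[OF that] bounded_linear_vec_nth[of i]] by (simp add: o_def)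
  have \<alpha>: "\<alpha> \<in> {0..\<alpha>}" using t by simp
  \<comment> \<open>Two forms of the same integral: the gauge integral serves continuity and
    differentiation, the Lebesgue integral serves sign arguments.\<close>
  have XHK: "X c t = integral {0..t} (\<lambda>s. \<phi> s $ \<iota> c)" if "t \<in> {0..\<alpha>}" for c t
    unfolding X_def m[OF that] set_lebesgue_integral_eq_integral(2)[OF \<phi>_sub[OF that]]
    using set_lebesgue_integral_eq_integral(1)[OF \<phi>_sub[OF that]] by simp
  have XL: "X c t = (LINT s:{0..t}|lebesgue. \<phi> s $ \<iota> c)" if "t \<in> {0..\<alpha>}" for c t
    using XHK[OF that] set_lebesgue_integral_eq_integral(2)[OF \<phi>c[OF that]] by simp
  have X0: "X c 0 = 0" for c using XHK[of 0] t by simp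
  have contX: "continuous_on {0..\<alpha>} (X c)" for c
    using indefinite_integral_continuous_1[OF set_lebesgue_integral_eq_integral(1)[OF \<phi>c[OF \<alpha>]]]
    by (rule continuous_on_eq) (simp add: XHK)
  have contv: "continuous_on {0..\<alpha>} (val c)" if "c \<in> {1..C}" for c
  proof -
    have "isCont (\<lambda>x. f c x 0) x" for x using f_deriv[OF that, of x] DERIV_isCont by blast
    then have "continuous_on UNIV (\<lambda>x. f c x 0)" by (simp add: continuous_at_imp_continuous_on)
    then have "continuous_on {0..\<alpha>} (\<lambda>t. f c (b c - X c t) 0)"
      by (rule continuous_on_compose2) (auto intro!: continuous_intros contX)
    then show ?thesis unfolding val_def using f_shift[of c "b c"] by simp
  qed
  have contW: "continuous_on {0..\<alpha>} W"
    unfolding W_def[abs_def] by (intro continuous_on_Max_image contv ne) auto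
  have W_ge: "val c t \<le> W t" if "c \<in> {1..C}" for c t
    unfolding W_def using that by (intro Max_ge) auto
  have W_eq: "\<exists>c\<in>{1..C}. W t = val c t" for t
  proof -
    have "W t \<in> (\<lambda>c. val c t) ` {1..C}" unfolding W_def using ne by (intro Max_in) auto
    then show ?thesis by blast
  qed
  have val_le_iff: "val c s \<le> val c t \<longleftrightarrow> X c t \<le> X c s" if "c \<in> {1..C}" for c s t
    unfolding val_def f_shift[of c "b c" "X c s"] f_shift[of c "b c" "X c t"]
    using f_less_iff[OF that, of "b c - X c t" "b c - X c s"] by (auto simp: not_less[symmetric])
  have field: "AE r in lebesgue. r \<in> {0..\<alpha>} \<longrightarrow>
      (\<forall>c\<in>{1..C}. (val c r < W r \<longrightarrow> \<phi> r $ \<iota> c = 0) \<and> (0 \<le> W r \<longrightarrow> 0 \<le> \<phi> r $ \<iota> c) \<and>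
        (W r \<le> 0 \<longrightarrow> \<phi> r $ \<iota> c \<le> 0)) \<and> (\<Sum>c=1..C. \<phi> r $ \<iota> c) = W r"
    using AE
  proof eventually_elim
    case (elim r)
    show ?case
      using greedy_fieldD[OF \<iota> _ W_def[unfolded val_def X_def], of "\<phi> r" r] elim
      unfolding val_def X_def by blast
  qed
  have W0: "W 0 = y 1"
  proof -
    have "val c 0 = y c" for c by (simp add: val_def X0 y_def)
    then show ?thesis
      unfolding W_def using y_le_y_1 one_in by (intro Max_eqI) auto
  qed
  \<comment> \<open>An inactive class has zero velocity, so either alternative fixes the sign almost
    everywhere.\<close>
  have mono: "X c s \<le> X c t"
    if "c \<in> {1..C}" "0 \<le> s" "s \<le> t" "t \<le> \<alpha>" "\<And>r. s < r \<Longrightarrow> r \<le> t \<Longrightarrow> 0 \<le> W r \<or> val c r < W r" for c s t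
  proof -
    have "AE r in lebesgue. r \<in> {s<..t} \<longrightarrow> 0 \<le> \<phi> r $ \<iota> c"
      using field by eventually_elim (use that in force)
    then show ?thesis
      using set_lebesgue_integral_mono_AE_interval[OF \<phi>c[OF \<alpha>] that(2-4)] XL that by simp
  qed
  have anti: "X c t \<le> X c s"
    if "c \<in> {1..C}" "0 \<le> s" "s \<le> t" "t \<le> \<alpha>" "\<And>r. s < r \<Longrightarrow> r \<le> t \<Longrightarrow> W r \<le> 0 \<or> val c r < W r" for c s t
  proof -
    have "AE r in lebesgue. r \<in> {s<..t} \<longrightarrow> \<phi> r $ \<iota> c \<le> 0"
      using field by eventually_elim (use that in force)
    then show ?thesis
      using set_lebesgue_integral_antimono_AE_interval[OF \<phi>c[OF \<alpha>] that(2-4)] XL that by simp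
  qed
  \<comment> \<open>After the last time \<open>s\<close> with \<open>W s \<ge> 0\<close> no
    coordinate increases, so the class maximal at \<open>s\<close> keeps at least its rate and
    \<open>W s \<le> W t\<close>.\<close>
  have W_nonneg: "W t \<ge> 0" if t: "t \<in> {0..\<alpha>}" for t
  proof (rule ccontr)
    assume "\<not> W t \<ge> 0"
    then obtain s where s: "0 \<le> s" "s < t" "W s \<ge> 0" "\<And>r. s < r \<Longrightarrow> r \<le> t \<Longrightarrow> W r < 0"
      using last_nonneg_point[of 0 t W] continuous_on_subset[OF contW, of "{0..t}"] t W0 y_1_pos
      by auto
    obtain c where c: "c \<in> {1..C}" "W s = val c s" using W_eq by blast
    have "X c t \<le> X c s" by (rule anti[OF c(1)]) (use s t in \<open>auto intro: less_imp_le\<close>)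
    then have "W s \<le> val c t" using val_le_iff[OF c(1)] c(2) by simp
    also have "\<dots> \<le> W t" by (rule W_ge[OF c(1)])
    finally show False using s \<open>\<not> W t \<ge> 0\<close> by simp
  qed
  have X_mono: "X c s \<le> X c t" if "c \<in> {1..C}" "0 \<le> s" "s \<le> t" "t \<le> \<alpha>" for c s t
    by (rule mono[OF that]) (use that W_nonneg in auto)
  have W_anti: "W t \<le> W s" if "0 \<le> s" "s \<le> t" "t \<le> \<alpha>" for s t
  proof -
    obtain c where c: "c \<in> {1..C}" "W t = val c t" using W_eq by blast
    then show ?thesis
      using val_le_iff[OF c(1), of t s] X_mono[OF c(1) that] W_ge[OF c(1), of s] by simp
  qed
  \<comment> \<open>A class once active stays active: since the last time \<open>s\<close> of
    activity its coordinate could not grow, so its rate at \<open>t\<close> is at least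
    \<open>W s \<ge> W t\<close>. An inactive class was thus never active and never moved.\<close>
  have inactive: "X c t = 0" if c: "c \<in> {1..C}" and t: "t \<in> {0..\<alpha>}" and less: "val c t < W t" for c t
  proof (cases "\<exists>a\<in>{0..t}. val c a = W a")
    case True
    then obtain a where a: "0 \<le> a" "a \<le> t" "val c a = W a" by auto
    have "continuous_on {a..t} (\<lambda>r. val c r - W r)"
      using a t by (intro continuous_intros continuous_on_subset[OF contv[OF c]]
          continuous_on_subset[OF contW]) auto
    then obtain s where s: "a \<le> s" "s < t" "val c s - W s \<ge> 0"
      "\<And>r. s < r \<Longrightarrow> r \<le> t \<Longrightarrow> val c r - W r < 0"
      using last_nonneg_point[of a t "\<lambda>r. val c r - W r"] a less by auto
    have "X c t \<le> X c s" by (rule anti[OF c]) (use s t a in force)+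
    then have "val c s \<le> val c t" using val_le_iff[OF c] by simp
    then show ?thesis using less s W_anti[of s t] a t by auto
  next
    case False
    then have "val c r < W r" if "0 \<le> r" "r \<le> t" for r
      using W_ge[OF c, of r] that by force
    then have "X c t \<le> X c 0" by (intro anti[OF c]) (use t in auto)
    moreover have "X c 0 \<le> X c t" using X_mono[OF c, of 0 t] t by simp
    ultimately show ?thesis by (simp add: X0)
  qed
  have W_less_1: "W t < 1" for t
    using W_eq[of t] f_less_1 by (auto simp: val_def)
  have X_eq: "X c t = max 0 (b c - h c (W t))" if c: "c \<in> {1..C}" and t: "t \<in> {0..\<alpha>}" for c t
  proof (cases "val c t < W t")
    case True
    then have "X c t = 0" by (rule inactive[OF that])
    moreover have "y c < W t" using True \<open>X c t = 0\<close> by (simp add: val_def y_def)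
    then have "b c < h c (W t)" using h_less_iff[OF c y_less_1[OF c] W_less_1] h_y[OF c] by simp
    ultimately show ?thesis by simp
  next
    case False
    then have "val c t = W t" using W_ge[OF c, of t] by simp
    then have "b c - h c (W t) = X c t" using f_left_inverse[OF c, of "b c" "X c t"] by (simp add: val_def)
    moreover have "X c t \<ge> 0" using X_mono[OF c, of 0 t] t X0 by simp
    ultimately show ?thesis by simp
  qed
  define M where "M t = (\<Sum>c=1..C. X c t)" for t
  have W_M: "W t = lev_inv total (M t)" if t: "t \<in> {0..\<alpha>}" for t
  proof -
    have "W t \<le> y 1" using W_anti[of 0 t] t W0 by simp
    then have "M t = total (W t)" using X_eq t by (simp add: total_eq M_def)
    then show ?thesis by (simp add: lev_inv_left[OF level_fun_total W_less_1])
  qed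
  \<comment> \<open>The velocities sum to \<open>W\<close> almost everywhere; as \<open>W\<close> is
    continuous, the integral form gives a derivative at every time.\<close>
  have M_int: "M t = integral {0..t} W" if t: "t \<in> {0..\<alpha>}" for t
  proof -
    have "AE r in lebesgue. r \<in> {0..\<alpha>} \<longrightarrow> (\<Sum>c=1..C. \<phi> r $ \<iota> c) = W r"
      using field by eventually_elim blast
    then obtain N where N: "N \<in> null_sets lebesgue"
      and "{r \<in> space lebesgue. \<not> (r \<in> {0..\<alpha>} \<longrightarrow> (\<Sum>c=1..C. \<phi> r $ \<iota> c) = W r)} \<subseteq> N"
      unfolding eventually_ae_filter by blast
    then have N_eq: "(\<Sum>c=1..C. \<phi> r $ \<iota> c) = W r" if "r \<in> {0..\<alpha>} - N" for r
      using that by auto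
    have "M t = integral {0..t} (\<lambda>s. \<Sum>c=1..C. \<phi> s $ \<iota> c)"
      unfolding M_def XHK[OF t]
      using set_lebesgue_integral_eq_integral(1)[OF \<phi>c[OF t]] by (intro integral_sum[symmetric]) auto
    also have "\<dots> = integral {0..t} W"
      using N N_eq t by (intro integral_spike[of N]) (auto simp: negligible_iff_null_sets)
    finally show ?thesis .
  qed
  have "M t = mass t" if t: "t \<in> {0..\<alpha>}" for t
  proof (rule decreasing_ode_unique[where x = M and y = mass and S = \<alpha>,
        OF lev_inv_antimono[OF level_fun_total] _ _ _ t])
    show "(M has_real_derivative lev_inv total (M s)) (at s within {0..\<alpha>})" if s: "s \<in> {0..\<alpha>}" for s
    proof -
      have "((\<lambda>s. integral {0..s} W) has_real_derivative W s) (at s within {0..\<alpha>})"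
        by (rule integral_has_real_derivative[OF contW s])
      then show ?thesis
        unfolding W_M[OF s, symmetric]
        by (rule has_field_derivative_transform_within[OF _ zero_less_one s]) (simp add: M_int)
    qed
    show "(mass has_real_derivative lev_inv total (mass s)) (at s within {0..\<alpha>})" if s: "s \<in> {0..\<alpha>}" for s
      using mass_deriv[of s] s by (auto simp: u_def intro: has_field_derivative_at_within)
    show "M 0 = mass 0" by (simp add: M_def X0 mass_0)
  qed
  then have "W t = u t" using W_M[OF t] t by (simp add: u_def)
  then show ?thesis using X_eq[OF c t] by (simp add: X_def sol_def)
qed

end

section \<open>The exponential rates\<close>

context
  fixes D c :: nat and \<nu> :: "nat pmf" and a :: "nat \<Rightarrow> nat \<Rightarrow> real"
  assumes supp: "set_pmf \<nu> \<subseteq> {1..D}" and a_pos: "\<And>d. d \<in> {1..D} \<Longrightarrow> a c d > 0"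
begin

text \<open>Single weights of \<open>\<nu>\<close> may vanish, but its support is nonempty and
  inside \<open>{1..D}\<close>, so one term is positive.\<close>

lemma sum_weighted_pmf_pos:
  assumes "\<And>d. d \<in> {1..D} \<Longrightarrow> w d > 0"
  shows "(\<Sum>d=1..D. w d * pmf \<nu> d) > 0"
proof -
  obtain e where "e \<in> set_pmf \<nu>" using set_pmf_not_empty[of \<nu>] by blast
  then have "e \<in> {1..D}" "pmf \<nu> e > 0" using supp by (auto simp: pmf_positive)
  then show ?thesis
    using assms by (intro sum_pos2[of _ e]) (auto simp: less_imp_le)
qed

lemma rate_deriv: "\<exists>K>0. ((\<lambda>x. rate D \<nu> a c x 0) has_real_derivative K) (at x)"
proof (intro exI conjI)
  show "(\<Sum>d=1..D. a c d * exp (- a c d * x) * pmf \<nu> d) > 0"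
    using a_pos by (intro sum_weighted_pmf_pos) auto
  show "((\<lambda>x. rate D \<nu> a c x 0) has_real_derivative
      (\<Sum>d=1..D. a c d * exp (- a c d * x) * pmf \<nu> d)) (at x)"
    unfolding rate_def by (intro DERIV_sum) (auto intro!: derivative_eq_intros)
qed

text \<open>From \<open>1 - exp (- x) \<le> x\<close>, valid for negative \<open>x\<close> too; this
  yields both sublinearity and points of arbitrarily small rate.\<close>

lemma rate_le_linear: "rate D \<nu> a c x 0 \<le> (\<Sum>d=1..D. a c d * pmf \<nu> d) * x"
proof -
  have "(1 - exp (- a c d * (x - 0))) * pmf \<nu> d \<le> a c d * pmf \<nu> d * x" for d
  proof -
    have "1 - exp (- a c d * x) \<le> a c d * x" using exp_ge_add_one_self[of "- a c d * x"] by simp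
    from mult_right_mono[OF this, of "pmf \<nu> d"] show ?thesis by (simp add: mult_ac)
  qed
  then show ?thesis unfolding rate_def sum_distrib_right by (intro sum_mono)
qed

lemma rate_range: "range (\<lambda>x. rate D \<nu> a c x 0) = {..<1}"
proof
  have rate_eq: "rate D \<nu> a c x 0 = 1 - (\<Sum>d=1..D. exp (- a c d * x) * pmf \<nu> d)" for x
    using sum_pmf_eq_1[OF _ supp] by (simp add: rate_def left_diff_distrib sum_subtractf)
  have "(\<Sum>d=1..D. exp (- a c d * x) * pmf \<nu> d) > 0" for x
    by (intro sum_weighted_pmf_pos) auto
  then show "range (\<lambda>x. rate D \<nu> a c x 0) \<subseteq> {..<1}"
    unfolding rate_eq by auto
  show "{..<1} \<subseteq> range (\<lambda>x. rate D \<nu> a c x 0)"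
  proof
    fix v :: real assume v: "v \<in> {..<1}"
    \<comment> \<open>By \<open>rate_le_linear\<close> the rate at \<open>v / L\<close> is at most
      \<open>v\<close>, while it tends to 1 at infinity; the value \<open>v\<close> lies in
      between.\<close>
    define L where "L = (\<Sum>d=1..D. a c d * pmf \<nu> d)"
    have "L > 0" unfolding L_def by (intro sum_weighted_pmf_pos a_pos)
    then have low: "rate D \<nu> a c (v / L) 0 \<le> v" using rate_le_linear[of "v / L"] by (simp add: L_def)
    have "((\<lambda>x. 1 - (\<Sum>d=1..D. exp (- a c d * x) * pmf \<nu> d)) \<longlongrightarrow>
        1 - (\<Sum>d=1..D. 0 * pmf \<nu> d)) at_top"
    proof (intro tendsto_intros)
      fix d assume "d \<in> {1..D}"
      then have "filterlim (\<lambda>x. - a c d * x) at_bot at_top"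
        using a_pos[of d] by (intro filterlim_tendsto_neg_mult_at_bot[of _ "- a c d"] tendsto_const filterlim_ident) auto
      then show "((\<lambda>x. exp (- a c d * x)) \<longlongrightarrow> 0) at_top"
        by (rule filterlim_compose[OF exp_at_bot])
    qed
    then have "((\<lambda>x. rate D \<nu> a c x 0) \<longlongrightarrow> 1) at_top" by (simp add: rate_eq)
    then have "eventually (\<lambda>x. rate D \<nu> a c x 0 > v) at_top"
      using v by (intro order_tendstoD(1)[of _ 1]) auto
    from eventually_conj[OF this eventually_ge_at_top[of "v / L"]]
    obtain x where x: "rate D \<nu> a c x 0 > v" "v / L \<le> x"
      by (auto simp: eventually_at_top_linorder)
    have "isCont (\<lambda>x. rate D \<nu> a c x 0) x" for x using rate_deriv[of x] DERIV_isCont by blast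
    then obtain z where "rate D \<nu> a c z 0 = v"
      using IVT'[of "\<lambda>x. rate D \<nu> a c x 0" "v / L" v x] low x
      by (auto simp: continuous_at_imp_continuous_on)
    then show "v \<in> range (\<lambda>x. rate D \<nu> a c x 0)" by blast
  qed
qed

end

section \<open>Application to the exponential rates and passage to vectors\<close>

theorem theorem3:
  fixes N T C D :: nat and \<alpha> :: real
    and b :: "nat \<Rightarrow> real" and \<nu> :: "nat pmf" and a :: "nat \<Rightarrow> nat \<Rightarrow> real"
    and \<iota> :: "nat \<Rightarrow> 'n::finite"
  assumes "N \<ge> 1" "T \<ge> 1" "C \<ge> 1" "D \<ge> 1"
    and "\<alpha> > 0" "real T = \<alpha> * real N"
    and "\<And>c. c \<in> {1..C} \<Longrightarrow> b c \<ge> 0" "(\<Sum>c=1..C. b c) = 1"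
    and "set_pmf \<nu> \<subseteq> {1..D}"
    and "\<And>c d. c \<in> {1..C} \<Longrightarrow> d \<in> {1..D} \<Longrightarrow> a c d > 0"
    and "\<And>j k. 1 \<le> j \<Longrightarrow> j \<le> k \<Longrightarrow> k \<le> C \<Longrightarrow>
           rate D \<nu> a j (b j) 0 \<ge> rate D \<nu> a k (b k) 0"
    and "bij_betw \<iota> {1..C} (UNIV :: 'n set)"
  shows "incl_solution (greedy_field (rate D \<nu> a) b C \<iota>) \<alpha>
           (\<lambda>t. \<Sum>c=1..C. mstar (rate D \<nu> a) b (real T) C c t *\<^sub>R axis (\<iota> c) 1) \<and>
         (\<forall>m. incl_solution (greedy_field (rate D \<nu> a) b C \<iota>) \<alpha> m \<longrightarrow>
           (\<forall>t\<in>{0..\<alpha>}. m t = (\<Sum>c=1..C. mstar (rate D \<nu> a) b (real T) C c t *\<^sub>R axis (\<iota> c) 1)))"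
proof -
  have sublinear: "\<exists>L>0. \<forall>x\<ge>0. rate D \<nu> a 1 x 0 \<le> L * x"
    using rate_le_linear[of \<nu> D a 1] sum_weighted_pmf_pos[of \<nu> D a 1 "a 1"] assms(3,9,10)
    by (intro exI[of _ "\<Sum>d=1..D. a 1 d * pmf \<nu> d"]) auto
  interpret greedy_rates "rate D \<nu> a" b C
  proof unfold_locales
    show "rate D \<nu> a c \<beta> z = rate D \<nu> a c (\<beta> - z) 0" "rate D \<nu> a c 0 0 = 0" for c \<beta> z
      by (simp_all add: rate_def)
    show "\<exists>K>0. ((\<lambda>x. rate D \<nu> a c x 0) has_real_derivative K) (at x)"
      and "range (\<lambda>x. rate D \<nu> a c x 0) = {..<1}" if "c \<in> {1..C}" for c x
      using rate_deriv[of \<nu> D a c x] rate_range[of \<nu> D a c] assms(9,10) that by auto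
  qed (use assms(3,7,8,11) sublinear in auto)
  \<comment> \<open>\<open>N \<ge> 1\<close> places \<open>[0, \<alpha>]\<close> inside
    \<open>[0, T]\<close>, where \<open>mstar_eq\<close> holds.\<close>
  have "\<alpha> * 1 \<le> \<alpha> * real N" using assms(1,5) by (intro mult_left_mono) auto
  then have "\<alpha> \<le> real T" using assms(6) by simp
  then have mstar: "mstar (rate D \<nu> a) b (real T) C c t = sol c t"
    if "t \<in> {0..\<alpha>}" "c \<in> {1..C}" for c t
    using that by (simp add: mstar_eq sol_def)
  then have eq: "(\<Sum>c=1..C. mstar (rate D \<nu> a) b (real T) C c t *\<^sub>R axis (\<iota> c) (1::real)) =
      (\<Sum>c=1..C. sol c t *\<^sub>R axis (\<iota> c) 1)" if "t \<in> {0..\<alpha>}" for t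
    using that by (intro sum.cong) auto
  \<comment> \<open>Being a solution depends only on the values on \<open>{0..\<alpha>}\<close>,
    where both functions agree by \<open>eq\<close>.\<close>
  have "incl_solution (greedy_field (rate D \<nu> a) b C \<iota>) \<alpha>
      (\<lambda>t. \<Sum>c=1..C. mstar (rate D \<nu> a) b (real T) C c t *\<^sub>R axis (\<iota> c) 1)"
    using sol_incl_solution[OF assms(12), of \<alpha>] unfolding incl_solution_def by (simp add: eq)
  moreover have "m t = (\<Sum>c=1..C. mstar (rate D \<nu> a) b (real T) C c t *\<^sub>R axis (\<iota> c) 1)"
    if m: "incl_solution (greedy_field (rate D \<nu> a) b C \<iota>) \<alpha> m" and t: "t \<in> {0..\<alpha>}" for m t
  proof -
    have "m t = (\<Sum>c=1..C. (m t $ \<iota> c) *\<^sub>R axis (\<iota> c) 1)"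
      using sum_axis_vec[OF assms(12), of "m t"] by simp
    also have "\<dots> = (\<Sum>c=1..C. sol c t *\<^sub>R axis (\<iota> c) 1)"
      using incl_solution_unique[OF assms(12) m t] by (intro sum.cong) auto
    finally show ?thesis using eq[OF t] by simp
  qed
  ultimately show ?thesis by blast
qed

end
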